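(* Let $K(\varepsilon)$ be a real symmetric $n\times n$ analytic matrix perturbation of the form $$K(\varepsilon)=V\,\Delta(\varepsilon)\,(W+o(1))\,\Delta(\varepsilon)\,V^T\qquad(\varepsilon\to0),$$ where $\Delta(\varepsilon)=\mathrm{diag}(\varepsilon^{\nu_0}I_{a_0},\dots,\varepsilon^{\nu_p}I_{a_p})$ with $\nu_0<\dots<\nu_p$ and $a_i$ positive integers, $W=(W_{i,k})_{i,k=0}^p$ is a constant real symmetric invertible matrix with blocks $W_{i,k}\in\mathbb R^{a_i\times a_k}$, and $V=(V_0\ V_1\ \cdots\ V_p)$ with $V_i\in\mathbb R^{n\times a_i}$. Assume $\mathrm{rank}\,V=n$ and that $b_i>0$ for all $i$, where $b_0=\mathrm{rank}\,V_0$ and $b_i=\mathrm{rank}\,V_{\le i}-\mathrm{rank}\,V_{<i}$ for $i>0$. Let $V=QR$ be the block QR factorisation of $V$ with diagonal blocks $R_{i,i}$, let $$H=\mathrm{diag}(R_{0,0},\dots,R_{p,p})\;W\;\mathrm{diag}(R_{0,0}^T,\dots,R_{p,p}^T),$$ and let $S_0,\dots,S_p$ denote the Schur complements in $H$. 1. Then the asymptotic spectral equivalent of $K$ is $$\underline K(\varepsilon)=\sum_{i=0}^p\varepsilon^{2\nu_i}\,Q_iS_iQ_i^T .$$ 2. We have $S_0=R_{0,0}W_{0,0}R_{0,0}^T$, and for any $j>0$ such that $V_{\le j-1}$ has full column rank, $S_j$ admits a simpler expression via Schur complements of $W$: $$S_j=R_{j,j}\left(W_{j,j}-W_{j,<j}(W_{<j,<j})^{-1}W_{<j,j}\right)R_{j,j}^T,$$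 where $W_{j,<j}=(W_{j,0}\ W_{j,1}\ \cdots\ W_{j,j-1})$, $W_{<j,j}=W_{j,<j}^T$ and $W_{<j,<j}=(W_{i,k})_{i,k<j}$.
   Context: Notation: $V_{\le i}=(V_0\ \cdots\ V_i)$, $V_{<i}=(V_0\ \cdots\ V_{i-1})$. Since $\mathrm{rank}\,V=n$, $\sum b_i=n$. Block QR factorisation: $V=QR$ with $Q=(Q_0\ \cdots\ Q_p)\in\mathbb R^{n\times n}$ orthogonal, $Q_i\in\mathbb R^{n\times b_i}$, and $R=(R_{i,k})$ block upper triangular ($R_{i,k}=0$ for $i>k$) with $R_{i,k}\in\mathbb R^{b_i\times a_k}$. Schur complements of $H=(H_{i,k})$, $H_{i,k}\in\mathbb R^{b_i\times b_k}$: $S_0=H_{0,0}$ and, whenever $H_{<i,<i}=(H_{k,l})_{k,l<i}$ is invertible, $S_i=H_{i,i}-H_{i,<i}(H_{<i,<i})^{-1}H_{<i,i}$, where $H_{i,<i}=(H_{i,0}\cdots H_{i,i-1})$, $H_{<i,i}=H_{i,<i}^T$. Asymptotic spectral equivalent (ASE): let $K(\varepsilon)$ be real symmetric and analytic near $\varepsilon=0$. By Rellich's theorem there are analytic eigenvalues $\lambda_k(\varepsilon)$ and analytic orthonormal eigenvectors $u_k(\varepsilon)$. If $\lambda_k\not\equiv0$, write $\lambda_k(\varepsilon)=\varepsilon^{\alpha}(\tilde\lambda_k+O(\varepsilon))$, $\tilde\lambda_k\neq0$, and $\mathrm{lt}(\lambda_k)=\tilde\lambda_k\varepsilon^\alpha$;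 if $\lambda_k\equiv 0$ set $\mathrm{lt}(\lambda_k)=0$. With $\tilde u_k=u_k(0)$, the ASE is $\underline K(\varepsilon)=\sum_k\mathrm{lt}(\lambda_k)(\varepsilon)\,\tilde u_k\tilde u_k^T$ (independent of choices).
   Formalization: Part 1 also assumes H invertible (besides the H_{<i,<i} needed to define S_i); otherwise it fails: n=1, p=0, ν_0=0, V=(1 1), W=diag(1,-1), K=ε=V(W+diag(ε,0))V^T gives H=S_0=0 but the ASE is ε. *)

theory Defs
  imports
    "HOL-Analysis.FPS_Convergence"
    "HOL-Library.Landau_Symbols"
    "Jordan_Normal_Form.DL_Rank"
    "Jordan_Normal_Form.DL_Submatrix"
    "Jordan_Normal_Form.Gauss_Jordan_Elimination"
begin

text \<open>Block sizes are given by a function on block indices; blocks and rows/columns are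
  counted from 0.  Blocks are cut out with \<^const>\<open>submatrix\<close>, whose second and third
  argument are the sets of selected row and column indices.\<close>

definition blk_offset :: "(nat \<Rightarrow> nat) \<Rightarrow> nat \<Rightarrow> nat" where
  "blk_offset a i = (\<Sum>k<i. a k)"

definition blk :: "(nat \<Rightarrow> nat) \<Rightarrow> nat \<Rightarrow> nat set" where
  "blk a i = {blk_offset a i ..< blk_offset a (Suc i)}"

definition blks_less :: "(nat \<Rightarrow> nat) \<Rightarrow> nat \<Rightarrow> nat set" where
  "blks_less a i = {..< blk_offset a i}"

definition block :: "(nat \<Rightarrow> nat) \<Rightarrow> (nat \<Rightarrow> nat) \<Rightarrow> 'a mat \<Rightarrow> nat \<Rightarrow> nat \<Rightarrow> 'a mat" where
  "block r c M i k = submatrix M (blk r i) (blk c k)"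

definition block_col :: "(nat \<Rightarrow> nat) \<Rightarrow> 'a mat \<Rightarrow> nat \<Rightarrow> 'a mat" where
  "block_col a M i = submatrix M UNIV (blk a i)"

definition block_cols_less :: "(nat \<Rightarrow> nat) \<Rightarrow> 'a mat \<Rightarrow> nat \<Rightarrow> 'a mat" where
  "block_cols_less a M i = submatrix M UNIV (blks_less a i)"

definition leading_blocks :: "(nat \<Rightarrow> nat) \<Rightarrow> 'a mat \<Rightarrow> nat \<Rightarrow> 'a mat" where
  "leading_blocks a M i = submatrix M (blks_less a i) (blks_less a i)"

definition block_row_less :: "(nat \<Rightarrow> nat) \<Rightarrow> 'a mat \<Rightarrow> nat \<Rightarrow> 'a mat" where
  "block_row_less a M i = submatrix M (blk a i) (blks_less a i)"

definition block_rank_increment :: "nat \<Rightarrow> (nat \<Rightarrow> nat) \<Rightarrow> real mat \<Rightarrow> nat \<Rightarrow> nat" where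
  "block_rank_increment n a V i =
     (if i = 0 then vec_space.rank n (block_col a V 0)
      else vec_space.rank n (block_cols_less a V (Suc i))
         - vec_space.rank n (block_cols_less a V i))"

text \<open>For \<open>i > 0\<close> meaningful only if \<^term>\<open>leading_blocks a M i\<close> is invertible;
  otherwise \<^const>\<open>mat_inverse\<close> returns \<^term>\<open>None\<close>.\<close>

definition block_schur :: "(nat \<Rightarrow> nat) \<Rightarrow> real mat \<Rightarrow> nat \<Rightarrow> real mat" where
  "block_schur a M i =
     (if i = 0 then block a a M 0 0
      else block a a M i i
         - block_row_less a M i * the (mat_inverse (leading_blocks a M i))
             * (block_row_less a M i)\<^sup>T)"

definition block_qr ::
  "nat \<Rightarrow> nat \<Rightarrow> (nat \<Rightarrow> nat) \<Rightarrow> (nat \<Rightarrow> nat) \<Rightarrow> real mat \<Rightarrow> real mat \<Rightarrow> real mat \<Rightarrow> bool" where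
  "block_qr n p a b V Q R \<longleftrightarrow>
     Q \<in> carrier_mat n n \<and> Q\<^sup>T * Q = 1\<^sub>m n \<and>
     R \<in> carrier_mat n (blk_offset a (Suc p)) \<and>
     (\<forall>i\<le>p. \<forall>k<i. block b a R i k = 0\<^sub>m (b i) (a k)) \<and>
     V = Q * R"

text \<open>Only meaningful for \<open>\<epsilon> > 0\<close>, since the exponents are real.\<close>

definition powr_diag :: "nat \<Rightarrow> (nat \<Rightarrow> nat) \<Rightarrow> (nat \<Rightarrow> real) \<Rightarrow> real \<Rightarrow> real mat" where
  "powr_diag p a \<nu> \<epsilon> = diag_block_mat (map (\<lambda>i. (\<epsilon> powr \<nu> i) \<cdot>\<^sub>m 1\<^sub>m (a i)) [0..<Suc p])"

definition mat_sum :: "nat \<Rightarrow> ('i \<Rightarrow> real mat) \<Rightarrow> 'i set \<Rightarrow> real mat" where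
  "mat_sum n F I = mat n n (\<lambda>(s, t). \<Sum>i\<in>I. F i $$ (s, t))"

definition analytic_at_0 :: "(real \<Rightarrow> real) \<Rightarrow> bool" where
  "analytic_at_0 f \<longleftrightarrow> (\<exists>F. f has_fps_expansion F)"

definition analytic_sym_mat :: "nat \<Rightarrow> (real \<Rightarrow> real mat) \<Rightarrow> bool" where
  "analytic_sym_mat n K \<longleftrightarrow>
     (\<forall>\<epsilon>. K \<epsilon> \<in> carrier_mat n n) \<and>
     (\<forall>i<n. \<forall>j<n. analytic_at_0 (\<lambda>\<epsilon>. K \<epsilon> $$ (i, j))) \<and>
     (\<forall>\<^sub>F \<epsilon> in nhds 0. (K \<epsilon>)\<^sup>T = K \<epsilon>)"

text \<open>The analytic eigenvalues and orthonormal eigenvectors provided by Rellich's theorem.\<close>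

definition analytic_eigensystem ::
  "nat \<Rightarrow> (real \<Rightarrow> real mat) \<Rightarrow> (nat \<Rightarrow> real \<Rightarrow> real) \<Rightarrow> (nat \<Rightarrow> real \<Rightarrow> real vec) \<Rightarrow> bool" where
  "analytic_eigensystem n K lam u \<longleftrightarrow>
     (\<forall>k<n. analytic_at_0 (lam k)) \<and>
     (\<forall>k<n. \<forall>\<epsilon>. u k \<epsilon> \<in> carrier_vec n) \<and>
     (\<forall>k<n. \<forall>i<n. analytic_at_0 (\<lambda>\<epsilon>. vec_index (u k \<epsilon>) i)) \<and>
     (\<forall>\<^sub>F \<epsilon> in nhds 0. \<forall>k<n. K \<epsilon> *\<^sub>v u k \<epsilon> = lam k \<epsilon> \<cdot>\<^sub>v u k \<epsilon>) \<and>
     (\<forall>\<^sub>F \<epsilon> in nhds 0. \<forall>k<n. \<forall>l<n. scalar_prod (u k \<epsilon>) (u l \<epsilon>) = (if k = l then 1 else 0))"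

text \<open>The condition on \<open>c\<close> and \<open>\<alpha>\<close> says \<open>f x = x ^ \<alpha> * (c + O(x))\<close>, multiplied out.\<close>

definition leading_term :: "(real \<Rightarrow> real) \<Rightarrow> real \<Rightarrow> real" where
  "leading_term f \<epsilon> =
     (if \<forall>\<^sub>F x in nhds 0. f x = 0 then 0
      else (THE y. \<exists>c (\<alpha>::nat). c \<noteq> 0 \<and>
              (\<lambda>x. f x - c * x ^ \<alpha>) \<in> O[at 0](\<lambda>x. x ^ Suc \<alpha>) \<and> y = c * \<epsilon> ^ \<alpha>))"

text \<open>The asymptotic spectral equivalent, computed from a given analytic eigensystem;
  the one-column matrix \<open>U\<close> below is the vector \<^term>\<open>u k 0\<close>.\<close>

definition ase :: "nat \<Rightarrow> (nat \<Rightarrow> real \<Rightarrow> real) \<Rightarrow> (nat \<Rightarrow> real \<Rightarrow> real vec) \<Rightarrow> real \<Rightarrow> real mat" where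
  "ase n lam u \<epsilon> =
     mat_sum n (\<lambda>k. let U = mat_of_cols n [u k 0] in leading_term (lam k) \<epsilon> \<cdot>\<^sub>m (U * U\<^sup>T)) {..<n}"

end

theory Submission
  imports Defs
begin

text \<open>Since \<open>R\<close> is block upper triangular, \<open>R \<Delta>\<^sub>a = \<Delta>\<^sub>b (D + o(1))\<close>, whence
  \<open>K(\<epsilon>) = Q \<Delta>\<^sub>b (H + o(1)) \<Delta>\<^sub>b Q\<^sup>T\<close>.  For an eigenpair with \<open>\<lambda> \<sim> c \<epsilon>\<^sup>\<alpha>\<close>, the vector
  \<open>z = \<epsilon>\<^bsup>-\<alpha>/2\<^esup> \<Delta>\<^sub>b Q\<^sup>T u\<close> converges, because the leading blocks of \<open>H\<close> are invertible.  Passing to the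
  limit in the eigenvalue equation forces \<open>\<alpha> = 2 \<nu>\<^sub>m\<close> for some \<open>m\<close>, shows that \<open>Q\<^sup>T u(0)\<close> is supported on
  block \<open>m\<close>, and, after elimination of the blocks before \<open>m\<close>, that it is there an eigenvector of \<open>S\<^sub>m\<close>
  for the eigenvalue \<open>c\<close>.  Hence both sides of the claimed formula act in the same way on the orthonormal
  basis of the \<open>u\<^sub>k(0)\<close>.\<close>

section \<open>Slices of matrices and block indices\<close>

text \<open>The obstacle is that only \<open>Q\<^sup>T u\<close> is known to converge, while forming
  z divides it by positive powers of \<epsilon> on the blocks with 2 \<nu>_i < \<alpha>. On exactly
  those rows the rescaled eigenvalue equation has a right-hand side tending to 0, and this leaves a
  linear system for the endangered entries whose limit matrix is a leading block of H. Once z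
  converges, \<open>Q\<^sup>T u(0)\<close> vanishes where 2 \<nu>_i < \<alpha>, being the limit of z
  times a positive power of \<epsilon>; where 2 \<nu>_i > \<alpha> the equation, multiplied by a
  positive power, gives c times the entry = 0. A unit vector does not vanish everywhere, so a block
  with 2 \<nu>_m = \<alpha> remains, unique by strict monotonicity. A Schur complement appears
  because the limit of z may be nonzero on the blocks before m, although
  \<open>Q\<^sup>T u(0)\<close> is zero there: those entries are fixed by the condition that the
  rows of H before m annihilate the limit. Comparing both sides on the u_k(0) handles one eigenpair
  at a time, so no multiplicities have to be counted and the spectra of different S_i may overlap
  freely.\<close>

definition slice :: "'a mat \<Rightarrow> nat \<Rightarrow> nat \<Rightarrow> nat \<Rightarrow> nat \<Rightarrow> 'a mat" where
  "slice M r r' c c' = mat (r' - r) (c' - c) (\<lambda>(i, j). M $$ (r + i, c + j))"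

lemma slice_carrier [simp]: "slice M r r' c c' \<in> carrier_mat (r' - r) (c' - c)"
  and dim_slice [simp]: "dim_row (slice M r r' c c') = r' - r" "dim_col (slice M r r' c c') = c' - c"
  by (simp_all add: slice_def)

lemma slice_index [simp]:
  "i < r' - r \<Longrightarrow> j < c' - c \<Longrightarrow> slice M r r' c c' $$ (i, j) = M $$ (r + i, c + j)"
  by (simp add: slice_def)

text \<open>\<open>pick\<close> enumerates a set in increasing order, and r + i has exactly i
  elements of the interval below it. This turns \<open>submatrix\<close> on intervals into a mere
  shift of indices.\<close>

lemma pick_atLeastLessThan: "i < r' - r \<Longrightarrow> pick {r..<r'} i = r + i"
proof -
  assume "i < r' - r"
  moreover have "{x\<in>{r..<r'}. x < r + i} = {r..<r + i}"
    using calculation by auto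
  ultimately show ?thesis
    using pick_card_in_set[of "r + i" "{r..<r'}"] by simp
qed

lemma submatrix_eq_slice:
  assumes "r' \<le> dim_row M" "c' \<le> dim_col M"
  shows "submatrix M {r..<r'} {c..<c'} = slice M r r' c c'"
proof -
  have "{i. i < dim_row M \<and> i \<in> {r..<r'}} = {r..<r'}" "{i. i < dim_col M \<and> i \<in> {c..<c'}} = {c..<c'}"
    using assms by auto
  then show ?thesis
    unfolding submatrix_def slice_def
    by (intro eq_matI) (auto simp: pick_atLeastLessThan)
qed

lemma submatrix_UNIV_eq_slice:
  assumes "c' \<le> dim_col M"
  shows "submatrix M UNIV {c..<c'} = slice M 0 (dim_row M) c c'"
proof -
  have "{i. i < dim_col M \<and> i \<in> {c..<c'}} = {c..<c'}"
    using assms by auto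
  then show ?thesis
    unfolding submatrix_def slice_def
    by (intro eq_matI) (auto simp: pick_atLeastLessThan pick_UNIV)
qed

lemma slice_transpose:
  assumes "r' \<le> dim_row M" "c' \<le> dim_col M"
  shows "slice (M\<^sup>T) c c' r r' = (slice M r r' c c')\<^sup>T"
  using assms by (intro eq_matI) auto

text \<open>A block of a product is in general a sum of block products. Since the selected rows of
  \<open>M\<close> live in the columns from c to c', the inner sum is truncated and a single product
  is left.\<close>

lemma slice_times:
  fixes M N :: "'a :: comm_semiring_0 mat"
  assumes M: "M \<in> carrier_mat m k" and N: "N \<in> carrier_mat k l"
    and "r' \<le> m" "c' \<le> k" "d' \<le> l"
    and zero: "\<And>i j. r \<le> i \<Longrightarrow> i < r' \<Longrightarrow> j < k \<Longrightarrow> \<not> (c \<le> j \<and> j < c') \<Longrightarrow> M $$ (i, j) = 0"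
  shows "slice (M * N) r r' d d' = slice M r r' c c' * slice N c c' d d'"
proof (rule eq_matI)
  fix i j
  assume "i < dim_row (slice M r r' c c' * slice N c c' d d')"
    and "j < dim_col (slice M r r' c c' * slice N c c' d d')"
  then have i: "i < r' - r" and j: "j < d' - d" by auto
  have "slice (M * N) r r' d d' $$ (i, j) = (\<Sum>t<k. M $$ (r + i, t) * N $$ (t, d + j))"
    using i j assms by (auto simp: scalar_prod_def atLeast0LessThan intro!: sum.cong)
  also have "\<dots> = (\<Sum>t\<in>{c..<c'}. M $$ (r + i, t) * N $$ (t, d + j))"
    using i j assms by (intro sum.mono_neutral_right) auto
  also have "\<dots> = (\<Sum>t<c' - c. M $$ (r + i, c + t) * N $$ (c + t, d + j))"
    by (rule sum.reindex_bij_witness[where i = "\<lambda>t. c + t" and j = "\<lambda>t. t - c"]) auto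
  also have "\<dots> = (slice M r r' c c' * slice N c c' d d') $$ (i, j)"
    using i j assms by (auto simp: scalar_prod_def atLeast0LessThan intro!: sum.cong)
  finally show "slice (M * N) r r' d d' $$ (i, j) = (slice M r r' c c' * slice N c c' d d') $$ (i, j)" .
qed auto

text \<open>Serves to read off diagonal blocks, leading blocks and row strips of H =
  \<open>D * W * D\<^sup>T\<close> for a block diagonal \<open>D\<close>, whose row blocks have the
  required zero pattern.\<close>

lemma slice_congruence:
  fixes D W :: "real mat"
  assumes D: "D \<in> carrier_mat m k" and W: "W \<in> carrier_mat k k"
    and le: "r' \<le> m" "c' \<le> k" "s' \<le> m" "d' \<le> k"
    and zr: "\<And>i j. r \<le> i \<Longrightarrow> i < r' \<Longrightarrow> j < k \<Longrightarrow> \<not> (c \<le> j \<and> j < c') \<Longrightarrow> D $$ (i, j) = 0"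
    and zs: "\<And>i j. s \<le> i \<Longrightarrow> i < s' \<Longrightarrow> j < k \<Longrightarrow> \<not> (d \<le> j \<and> j < d') \<Longrightarrow> D $$ (i, j) = 0"
  shows "slice (D * W * D\<^sup>T) r r' s s' = slice D r r' c c' * slice W c c' d d' * (slice D s s' d d')\<^sup>T"
proof -
  \<comment> \<open>\<open>slice_times\<close> truncates through the rows of the left factor only;
    the double transpose makes \<open>D\<close> the left factor both times.\<close>
  have "D * W * D\<^sup>T = D * (D * W\<^sup>T)\<^sup>T"
    using D W by (simp add: transpose_mult[of D m k "W\<^sup>T" k] assoc_mult_mat[of D m k W k "D\<^sup>T" m])
  also have "slice \<dots> r r' s s' = slice D r r' c c' * slice ((D * W\<^sup>T)\<^sup>T) c c' s s'"
    using D W le by (intro slice_times[OF D _ _ _ _ zr]) auto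
  also have "slice ((D * W\<^sup>T)\<^sup>T) c c' s s' = (slice (D * W\<^sup>T) s s' c c')\<^sup>T"
    using D W le by (intro slice_transpose) auto
  also have "slice (D * W\<^sup>T) s s' c c' = slice D s s' d d' * slice (W\<^sup>T) d d' c c'"
    using D W le by (intro slice_times[OF D _ _ _ _ zs]) auto
  also have "slice (W\<^sup>T) d d' c c' = (slice W c c' d d')\<^sup>T"
    using W le by (intro slice_transpose) auto
  also have "(slice D s s' d d' * (slice W c c' d d')\<^sup>T)\<^sup>T = slice W c c' d d' * (slice D s s' d d')\<^sup>T"
    by (subst transpose_mult) (auto intro!: transpose_carrier_mat)
  also have "slice D r r' c c' * (slice W c c' d d' * (slice D s s' d d')\<^sup>T) = 
    slice D r r' c c' * slice W c c' d d' * (slice D s s' d d')\<^sup>T"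
    by (rule assoc_mult_mat[symmetric]) (auto intro!: transpose_carrier_mat slice_carrier)
  finally show ?thesis .
qed

section \<open>Block offsets, and the block that contains a given index\<close>

lemma blk_offset_0 [simp]: "blk_offset a 0 = 0"
  and blk_offset_Suc: "blk_offset a (Suc i) = blk_offset a i + a i"
  by (simp_all add: blk_offset_def)

lemma blk_offset_mono: "i \<le> j \<Longrightarrow> blk_offset a i \<le> blk_offset a j"
  unfolding blk_offset_def by (rule sum_mono2) auto

text \<open>The number of the block containing \<open>s\<close>. The least i with \<open>s\<close>
  below the next offset skips empty blocks, so that \<open>s\<close> also lies at or above offset
  i.\<close>

definition blk_index :: "(nat \<Rightarrow> nat) \<Rightarrow> nat \<Rightarrow> nat" where
  "blk_index a s = (LEAST i. s < blk_offset a (Suc i))"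

lemma blk_index_eq:
  assumes "blk_offset a i \<le> s" "s < blk_offset a (Suc i)"
  shows "blk_index a s = i"
  unfolding blk_index_def
proof (rule Least_equality)
  fix j assume "s < blk_offset a (Suc j)"
  then show "i \<le> j"
    using assms blk_offset_mono[of "Suc j" i a] by (meson leD le_trans not_less_eq_eq)
qed (use assms in auto)

lemma blk_index_bounds:
  assumes "s < blk_offset a m"
  shows "blk_offset a (blk_index a s) \<le> s" "s < blk_offset a (Suc (blk_index a s))"
    "blk_index a s < m"
proof -
  obtain m' where m: "m = Suc m'"
    using assms by (cases m) auto
  have *: "s < blk_offset a (Suc m')" using assms m by simp
  show 1: "s < blk_offset a (Suc (blk_index a s))"
    unfolding blk_index_def using * by (rule LeastI)
  show "blk_index a s < m"
    unfolding blk_index_def m less_Suc_eq_le using * by (rule Least_le)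
  show "blk_offset a (blk_index a s) \<le> s"
  proof (cases "blk_index a s")
    case (Suc j)
    then show ?thesis
      using not_less_Least[of j "\<lambda>i. s < blk_offset a (Suc i)"] unfolding blk_index_def by auto
  qed simp
qed

lemma blk_index_less_iff:
  assumes "s < blk_offset a m"
  shows "blk_index a s < i \<longleftrightarrow> s < blk_offset a i"
  using blk_index_bounds[OF assms] blk_index_bounds(3)[of s a i] blk_offset_mono[of "Suc (blk_index a s)" i a]
  by auto

text \<open>The diagonal blocks may be rectangular, so lying on the block diagonal means that row
  and column have the same block number with respect to two different size functions. The induction
  splits off the last block.\<close>

lemma diag_block_mat_index:
  assumes "\<And>i. i < m \<Longrightarrow> F i \<in> carrier_mat (r i) (c i)"
  shows "diag_block_mat (map F [0..<m]) \<in> carrier_mat (blk_offset r m) (blk_offset c m)"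
    and "s < blk_offset r m \<Longrightarrow> t < blk_offset c m \<Longrightarrow>
      diag_block_mat (map F [0..<m]) $$ (s, t) =
       (if blk_index r s = blk_index c t
        then F (blk_index r s) $$ (s - blk_offset r (blk_index r s), t - blk_offset c (blk_index c t))
        else 0)"
proof -
  have "diag_block_mat (map F [0..<m]) \<in> carrier_mat (blk_offset r m) (blk_offset c m) \<and>
    (\<forall>s<blk_offset r m. \<forall>t<blk_offset c m. diag_block_mat (map F [0..<m]) $$ (s, t) =
       (if blk_index r s = blk_index c t
        then F (blk_index r s) $$ (s - blk_offset r (blk_index r s), t - blk_offset c (blk_index c t))
        else 0))"
    using assms
  proof (induction m)
    case (Suc m)
    let ?A = "diag_block_mat (map F [0..<m])"
    have A: "?A \<in> carrier_mat (blk_offset r m) (blk_offset c m)"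
      and Fm: "F m \<in> carrier_mat (r m) (c m)"
      and IH: "\<And>s t. s < blk_offset r m \<Longrightarrow> t < blk_offset c m \<Longrightarrow> ?A $$ (s, t) =
       (if blk_index r s = blk_index c t
        then F (blk_index r s) $$ (s - blk_offset r (blk_index r s), t - blk_offset c (blk_index c t))
        else 0)"
      using Suc by auto
    have eq: "diag_block_mat (map F [0..<Suc m]) =
      four_block_mat ?A (0\<^sub>m (blk_offset r m) (c m)) (0\<^sub>m (r m) (blk_offset c m)) (F m)"
      using A Fm by (simp add: diag_block_mat_last Let_def)
    have new: "blk_index x s = m" if "\<not> s < blk_offset x m" "s < blk_offset x (Suc m)" for x s
      using that by (intro blk_index_eq) auto
    have old: "blk_index x s \<noteq> m" if "s < blk_offset x m" for x s
      using that blk_index_bounds(3) by blast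
    have "diag_block_mat (map F [0..<Suc m]) $$ (s, t) =
       (if blk_index r s = blk_index c t
        then F (blk_index r s) $$ (s - blk_offset r (blk_index r s), t - blk_offset c (blk_index c t))
        else 0)" if s: "s < blk_offset r (Suc m)" and t: "t < blk_offset c (Suc m)" for s t
      unfolding eq using s t A Fm old[of s r] old[of t c] new[of s r] new[of t c]
      by (cases "s < blk_offset r m"; cases "t < blk_offset c m")
         (auto simp: IH blk_offset_Suc)
    moreover have "diag_block_mat (map F [0..<Suc m]) \<in> carrier_mat (blk_offset r (Suc m)) (blk_offset c (Suc m))"
      unfolding eq using A Fm by (auto simp: blk_offset_Suc)
    ultimately show ?case by blast
  qed (auto simp: blk_offset_def)
  then show "diag_block_mat (map F [0..<m]) \<in> carrier_mat (blk_offset r m) (blk_offset c m)"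
    and "s < blk_offset r m \<Longrightarrow> t < blk_offset c m \<Longrightarrow>
      diag_block_mat (map F [0..<m]) $$ (s, t) =
       (if blk_index r s = blk_index c t
        then F (blk_index r s) $$ (s - blk_offset r (blk_index r s), t - blk_offset c (blk_index c t))
        else 0)"
    by blast+
qed

section \<open>Invertibility, determinants and inverses\<close>

lemma invertible_mat_iff_det:
  fixes A :: "'a :: field mat"
  assumes A: "A \<in> carrier_mat n n"
  shows "invertible_mat A \<longleftrightarrow> det A \<noteq> 0"
proof
  assume "invertible_mat A"
  then obtain B where B: "A * B = 1\<^sub>m n" "B * A = 1\<^sub>m (dim_row B)"
    using A unfolding invertible_mat_def inverts_mat_def by auto
  have "B \<in> carrier_mat n n"
    using A B by (metis carrier_matD carrier_matI index_mult_mat(2,3) index_one_mat(2,3))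
  with B A show "det A \<noteq> 0"
    by (metis det_mult det_one mult_zero_left zero_neq_one)
next
  assume "det A \<noteq> 0"
  from det_non_zero_imp_unit[OF A this, where b = "()"] obtain B
    where "B \<in> carrier_mat n n" "A * B = 1\<^sub>m n" "B * A = 1\<^sub>m n"
    unfolding Units_def ring_mat_def by auto
  then show "invertible_mat A"
    using A unfolding invertible_mat_def inverts_mat_def by auto
qed

lemma the_mat_inverse:
  fixes A :: "'a :: field mat"
  assumes A: "A \<in> carrier_mat n n" and "det A \<noteq> 0"
  shows "the (mat_inverse A) \<in> carrier_mat n n"
    "A * the (mat_inverse A) = 1\<^sub>m n" "the (mat_inverse A) * A = 1\<^sub>m n"
proof -
  obtain B where "mat_inverse A = Some B"
    using mat_inverse(1)[OF A, where b = "()"] det_non_zero_imp_unit[OF assms, where b = "()"]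
    by (cases "mat_inverse A") (auto simp: ring_mat_def)
  with mat_inverse(2)[OF A this] show "the (mat_inverse A) \<in> carrier_mat n n"
    "A * the (mat_inverse A) = 1\<^sub>m n" "the (mat_inverse A) * A = 1\<^sub>m n" by auto
qed

section \<open>Entrywise limits and scaled eigenvectors\<close>

text \<open>The dimensions are required for every x and not just eventually, so that index
  computations under the limit need no side conditions on x.\<close>

definition entries_tendsto :: "('b \<Rightarrow> real mat) \<Rightarrow> real mat \<Rightarrow> nat \<Rightarrow> nat \<Rightarrow> 'b filter \<Rightarrow> bool" where
  "entries_tendsto M L m k F \<longleftrightarrow> (\<forall>x. M x \<in> carrier_mat m k) \<and> L \<in> carrier_mat m k \<and>
     (\<forall>i<m. \<forall>j<k. ((\<lambda>x. M x $$ (i, j)) \<longlongrightarrow> L $$ (i, j)) F)"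

lemma entries_tendsto_transpose:
  "entries_tendsto M L m k F \<Longrightarrow> entries_tendsto (\<lambda>x. (M x)\<^sup>T) (L\<^sup>T) k m F"
proof -
  assume M: "entries_tendsto M L m k F"
  then have "M x \<in> carrier_mat m k" for x by (simp add: entries_tendsto_def)
  from carrier_matD[OF this] M show ?thesis by (auto simp: entries_tendsto_def)
qed

lemma index_mult_mat_sum:
  assumes "A \<in> carrier_mat m k" "B \<in> carrier_mat k l" "i < m" "j < l"
  shows "(A * B) $$ (i, j) = (\<Sum>t<k. A $$ (i, t) * B $$ (t, j))"
  using assms by (auto simp: scalar_prod_def atLeast0LessThan intro!: sum.cong)

lemma entries_tendsto_times:
  assumes "entries_tendsto M L m k F" "entries_tendsto M' L' k l F"
  shows "entries_tendsto (\<lambda>x. M x * M' x) (L * L') m l F"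
proof -
  have c: "M x \<in> carrier_mat m k" "M' x \<in> carrier_mat k l" "L \<in> carrier_mat m k" "L' \<in> carrier_mat k l" for x
    using assms by (auto simp: entries_tendsto_def)
  have "((\<lambda>x. (M x * M' x) $$ (i, j)) \<longlongrightarrow> (L * L') $$ (i, j)) F" if ij: "i < m" "j < l" for i j
  proof -
    have "((\<lambda>x. \<Sum>t<k. M x $$ (i, t) * M' x $$ (t, j)) \<longlongrightarrow> (\<Sum>t<k. L $$ (i, t) * L' $$ (t, j))) F"
      using assms ij unfolding entries_tendsto_def by (intro tendsto_sum tendsto_mult) auto
    then show ?thesis
      by (simp add: index_mult_mat_sum[OF c(1,2) ij] index_mult_mat_sum[OF c(3,4) ij])
  qed
  moreover note mult_carrier_mat[OF c(1,2)] mult_carrier_mat[OF c(3,4)]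
  ultimately show ?thesis by (simp add: entries_tendsto_def)
qed

lemma tendsto_det:
  assumes "entries_tendsto M L n n F"
  shows "((\<lambda>x. det (M x)) \<longlongrightarrow> det L) F"
proof -
  have "((\<lambda>x. \<Sum>p\<in>{p. p permutes {0..<n}}. signof p * (\<Prod>i=0..<n. M x $$ (i, p i))) \<longlongrightarrow>
     (\<Sum>p\<in>{p. p permutes {0..<n}}. signof p * (\<Prod>i=0..<n. L $$ (i, p i)))) F"
    using assms unfolding entries_tendsto_def
    by (intro tendsto_sum tendsto_mult tendsto_prod tendsto_const) (auto dest: permutes_in_image)
  moreover have c: "M x \<in> carrier_mat n n" "L \<in> carrier_mat n n" for x
    using assms by (auto simp: entries_tendsto_def)
  ultimately show ?thesis unfolding det_def'[OF c(1)] det_def'[OF c(2)] by simp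
qed

text \<open>Up to sign the entries of the adjugate are determinants of minors, hence continuous in
  the entries of the matrix. The adjugate stands in for an inverse that exists only
  eventually.\<close>

lemma entries_tendsto_adj_mat:
  assumes "entries_tendsto M L n n F"
  shows "entries_tendsto (\<lambda>x. adj_mat (M x)) (adj_mat L) n n F"
proof -
  have c: "M x \<in> carrier_mat n n" "L \<in> carrier_mat n n" for x
    using assms by (auto simp: entries_tendsto_def)
  have "((\<lambda>x. adj_mat (M x) $$ (i, j)) \<longlongrightarrow> adj_mat L $$ (i, j)) F" if ij: "i < n" "j < n" for i j
  proof -
    have "entries_tendsto (\<lambda>x. mat_delete (M x) j i) (mat_delete L j i) (n - 1) (n - 1) F"
      using assms ij c unfolding entries_tendsto_def mat_delete_def
      by (auto simp: carrier_matD[OF c(1)] carrier_matD[OF c(2)])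
    then have "((\<lambda>x. (-1) ^ (j + i) * det (mat_delete (M x) j i)) \<longlongrightarrow>
       (-1) ^ (j + i) * det (mat_delete L j i)) F"
      by (intro tendsto_mult tendsto_const tendsto_det)
    then show ?thesis
      using ij c unfolding adj_mat_def cofactor_def
      by (simp add: carrier_matD[OF c(1)] carrier_matD[OF c(2)])
  qed
  then show ?thesis
    using adj_mat(1)[OF c(1)] adj_mat(1)[OF c(2)] by (simp add: entries_tendsto_def)
qed

text \<open>Cramer's rule: det(M) z = adj(M) (A z), where the right-hand side converges and det(M)
  tends to det(L), which is nonzero. Convergence of the unknown z is thus a conclusion; no bound on
  z enters.\<close>

lemma tendsto_solve_linear:
  fixes A :: "'b \<Rightarrow> nat \<Rightarrow> nat \<Rightarrow> real"
  assumes F: "F \<noteq> bot" and L: "L \<in> carrier_mat q q" "det L \<noteq> 0"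
    and A: "\<And>s t. s < q \<Longrightarrow> t < q \<Longrightarrow> ((\<lambda>x. A x s t) \<longlongrightarrow> L $$ (s, t)) F"
    and g: "\<And>s. s < q \<Longrightarrow> ((\<lambda>x. \<Sum>t<q. A x s t * z x t) \<longlongrightarrow> g s) F"
  obtains \<zeta> where "\<And>t. t < q \<Longrightarrow> ((\<lambda>x. z x t) \<longlongrightarrow> \<zeta> t) F"
    "\<And>s. s < q \<Longrightarrow> (\<Sum>t<q. L $$ (s, t) * \<zeta> t) = g s"
proof -
  define M where "M x = mat q q (\<lambda>(s, t). A x s t)" for x
  have M: "entries_tendsto M L q q F"
    using A L by (simp add: entries_tendsto_def M_def)
  have Mc: "M x \<in> carrier_mat q q" for x by (simp add: M_def)
  note adj = entries_tendsto_adj_mat[OF M]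
  have det: "((\<lambda>x. det (M x)) \<longlongrightarrow> det L) F"
    using M by (rule tendsto_det)
  \<comment> \<open>The solution of L \<zeta> = g, with the inverse of L written as adjugate over
    determinant.\<close>
  define \<zeta> where "\<zeta> s = (\<Sum>t<q. adj_mat L $$ (s, t) * g t) / det L" for s
  have cramer: "det (M x) * z x s = (\<Sum>t<q. adj_mat (M x) $$ (s, t) * (\<Sum>r<q. A x t r * z x r))"
    if s: "s < q" for x s
  proof -
    have "(\<Sum>t<q. adj_mat (M x) $$ (s, t) * (\<Sum>r<q. A x t r * z x r))
      = (\<Sum>r<q. (\<Sum>t<q. adj_mat (M x) $$ (s, t) * A x t r) * z x r)"
      unfolding sum_distrib_left sum_distrib_right by (subst sum.swap) (simp add: mult.assoc)
    also have "\<dots> = (\<Sum>r<q. (adj_mat (M x) * M x) $$ (s, r) * z x r)"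
      using s by (intro sum.cong refl arg_cong2[where f = "(*)"], subst index_mult_mat_sum[OF adj_mat(1)[OF Mc] Mc])
         (auto simp: M_def)
    also have "\<dots> = (\<Sum>r<q. if r = s then det (M x) * z x s else 0)"
      using s unfolding adj_mat(3)[OF Mc] by (intro sum.cong) auto
    also have "\<dots> = det (M x) * z x s" using s by (simp add: sum.delta)
    finally show ?thesis ..
  qed
  have ev: "\<forall>\<^sub>F x in F. det (M x) \<noteq> 0"
    using det L(2) by (rule tendsto_imp_eventually_ne)
  have lim: "((\<lambda>x. z x s) \<longlongrightarrow> \<zeta> s) F" if s: "s < q" for s
  proof -
    have "((\<lambda>x. (\<Sum>t<q. adj_mat (M x) $$ (s, t) * (\<Sum>r<q. A x t r * z x r)) / det (M x)) \<longlongrightarrow> \<zeta> s) F"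
      unfolding \<zeta>_def using adj s L det g unfolding entries_tendsto_def
      by (intro tendsto_divide tendsto_sum tendsto_mult) auto
    then show ?thesis
    proof (rule Lim_transform_eventually)
      show "\<forall>\<^sub>F x in F. (\<Sum>t<q. adj_mat (M x) $$ (s, t) * (\<Sum>r<q. A x t r * z x r)) / det (M x) = z x s"
        using ev by eventually_elim (simp flip: cramer[OF s])
    qed
  qed
  moreover have "(\<Sum>t<q. L $$ (s, t) * \<zeta> t) = g s" if s: "s < q" for s
  proof -
    have "((\<lambda>x. \<Sum>t<q. A x s t * z x t) \<longlongrightarrow> (\<Sum>t<q. L $$ (s, t) * \<zeta> t)) F"
      using A lim s by (intro tendsto_sum tendsto_mult) auto
    then show ?thesis using g[OF s] F tendsto_unique by blast
  qed
  ultimately show thesis using that by blast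
qed

section \<open>One-sided limits of real powers\<close>

lemma tendsto_powr_at_right_0:
  "r > 0 \<Longrightarrow> ((\<lambda>x::real. x powr r) \<longlongrightarrow> 0) (at_right 0)"
  by (rule tendsto_zero_powrI) (auto intro: tendsto_ident_at simp: eventually_at_right_less eventually_at_filter)

lemma eventually_pos_at_right_0: "\<forall>\<^sub>F x::real in at_right 0. x > 0"
  by (simp add: eventually_at_filter)

text \<open>\<open>0 powr 0\<close> is 0, so the function is the constant 1 only away from the
  origin; the limit comes from eventual equality.\<close>

lemma tendsto_powr_0_at_right_0: "((\<lambda>x::real. x powr 0) \<longlongrightarrow> 1) (at_right 0)"
  by (rule tendsto_eventually) (use eventually_pos_at_right_0 in eventually_elim, simp)

text \<open>The rescaled vector \<open>z s = e powr (\<mu> s - \<alpha> / 2) * v s\<close> satisfies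
  \<open>A z = \<lambda> e\<^bsup>-\<alpha>\<^esup> (e powr (\<alpha> / 2 - \<mu> s) * v s)\<close>.  Its entries with \<open>2 \<mu> s \<ge> \<alpha>\<close> converge for
  trivial reasons; those with \<open>2 \<mu> s < \<alpha>\<close> then solve a linear system with convergent data and
  invertible limit matrix \<open>L\<close>, so they converge as well, and \<open>y\<close> is the limit of \<open>z\<close>.\<close>

lemma scaled_eigenvector_limit:
  fixes A :: "real \<Rightarrow> nat \<Rightarrow> nat \<Rightarrow> real" and v :: "real \<Rightarrow> nat \<Rightarrow> real"
  assumes A: "\<And>s t. s < n \<Longrightarrow> t < n \<Longrightarrow> ((\<lambda>e. A e s t) \<longlongrightarrow> H $$ (s, t)) (at_right 0)"
    and v: "\<And>s. s < n \<Longrightarrow> ((\<lambda>e. v e s) \<longlongrightarrow> w s) (at_right 0)"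
    and lam: "((\<lambda>e. lam e * e powr (-\<alpha>)) \<longlongrightarrow> c) (at_right 0)"
    and eig: "\<forall>\<^sub>F e in at_right 0. \<forall>s<n. (\<Sum>t<n. e powr (\<mu> s + \<mu> t) * A e s t * v e t) = lam e * v e s"
    and q: "q \<le> n" "\<And>s. s < n \<Longrightarrow> s < q \<longleftrightarrow> 2 * \<mu> s < \<alpha>"
    and L: "L \<in> carrier_mat q q" "det L \<noteq> 0" "\<And>s t. s < q \<Longrightarrow> t < q \<Longrightarrow> L $$ (s, t) = H $$ (s, t)"
  obtains y where
    "\<And>s. s < n \<Longrightarrow> 2 * \<mu> s = \<alpha> \<Longrightarrow> y s = w s"
    "\<And>s. s < n \<Longrightarrow> 2 * \<mu> s > \<alpha> \<Longrightarrow> y s = 0"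
    "\<And>s. s < n \<Longrightarrow> 2 * \<mu> s < \<alpha> \<Longrightarrow> w s = 0"
    "\<And>s. s < n \<Longrightarrow> 2 * \<mu> s < \<alpha> \<Longrightarrow> (\<Sum>t<n. H $$ (s, t) * y t) = 0"
    "\<And>s. s < n \<Longrightarrow> 2 * \<mu> s = \<alpha> \<Longrightarrow> (\<Sum>t<n. H $$ (s, t) * y t) = c * w s"
    "\<And>s. s < n \<Longrightarrow> 2 * \<mu> s > \<alpha> \<Longrightarrow> c * w s = 0"
proof -
  let ?F = "at_right (0::real)"
  have bot: "?F \<noteq> bot" by simp
  define z where "z e s = e powr (\<mu> s - \<alpha> / 2) * v e s" for e s
  have pos: "\<forall>\<^sub>F e in ?F. e > 0" by (rule eventually_pos_at_right_0)
  have eq: "\<forall>\<^sub>F e in ?F. (\<Sum>t<n. A e s t * z e t) = lam e * e powr (-\<alpha>) * (e powr (\<alpha> / 2 - \<mu> s) * v e s)"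
    if s: "s < n" for s
    using eig pos
  proof eventually_elim
    case (elim e)
    \<comment> \<open>The factor with exponent - \<mu> s - \<alpha> / 2 cancels the row weight \<mu>
      s and turns the column weight \<mu> t into the weight \<mu> t - \<alpha> / 2 of z.\<close>
    have "(\<Sum>t<n. A e s t * z e t) = (\<Sum>t<n. e powr (\<mu> s + \<mu> t) * A e s t * v e t) * e powr (- \<mu> s - \<alpha> / 2)"
      unfolding sum_distrib_right z_def
    proof (rule sum.cong)
      fix t
      have "e powr (\<mu> t - \<alpha> / 2) = e powr (\<mu> s + \<mu> t) * e powr (- \<mu> s - \<alpha> / 2)"
        by (simp flip: powr_add)
      then show "A e s t * (e powr (\<mu> t - \<alpha> / 2) * v e t) =
        e powr (\<mu> s + \<mu> t) * A e s t * v e t * e powr (- \<mu> s - \<alpha> / 2)" by simp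
    qed simp
    also have "\<dots> = lam e * v e s * e powr (- \<mu> s - \<alpha> / 2)" using elim s by simp
    also have "e powr (- \<mu> s - \<alpha> / 2) = e powr (-\<alpha>) * e powr (\<alpha> / 2 - \<mu> s)"
      unfolding powr_add[symmetric] by (rule arg_cong[where f = "(powr) e"]) simp
    finally show ?case by simp
  qed
  have z_hi: "((\<lambda>e. z e t) \<longlongrightarrow> (if 2 * \<mu> t = \<alpha> then w t else 0)) ?F" if t: "t < n" "\<not> t < q" for t
  proof (cases "2 * \<mu> t = \<alpha>")
    case True
    have 0: "\<mu> t - \<alpha> / 2 = 0" using True by simp
    have "((\<lambda>e. z e t) \<longlongrightarrow> 1 * w t) ?F"
      unfolding z_def 0 by (intro tendsto_mult tendsto_powr_0_at_right_0 v t)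
    then show ?thesis unfolding if_P[OF True] mult_1 .
  next
    case False
    then have "((\<lambda>e. z e t) \<longlongrightarrow> 0 * w t) ?F"
      unfolding z_def using q(2)[of t] t by (intro tendsto_mult tendsto_powr_at_right_0 v t) auto
    with False show ?thesis by simp
  qed
  define y0 where "y0 t = (if 2 * \<mu> t = \<alpha> then w t else 0)" for t
  have rhs_lo: "((\<lambda>e. \<Sum>t<n. A e s t * z e t) \<longlongrightarrow> 0) ?F" if s: "s < n" "s < q" for s
  proof -
    have "((\<lambda>e. lam e * e powr (-\<alpha>) * (e powr (\<alpha> / 2 - \<mu> s) * v e s)) \<longlongrightarrow> c * (0 * w s)) ?F"
      using q(2)[of s] s by (intro tendsto_mult lam tendsto_powr_at_right_0 v) auto
    then show ?thesis
      unfolding tendsto_cong[OF eq[OF s(1)]] by simp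
  qed
  have split: "(\<Sum>t<n. f t) = (\<Sum>t<q. f t) + (\<Sum>t\<in>{q..<n}. f t)" for f :: "nat \<Rightarrow> real"
    using q(1) by (metis atLeast0LessThan le0 sum.atLeastLessThan_concat)
  \<comment> \<open>In a row below q the whole sum tends to 0, so the part over the entries already
    known to converge can be moved to the right-hand side.\<close>
  have g: "((\<lambda>e. \<Sum>t<q. A e s t * z e t) \<longlongrightarrow> 0 - (\<Sum>t\<in>{q..<n}. H $$ (s, t) * y0 t)) ?F" if s: "s < q" for s
  proof -
    have "((\<lambda>e. (\<Sum>t<n. A e s t * z e t) - (\<Sum>t\<in>{q..<n}. A e s t * z e t)) \<longlongrightarrow>
       0 - (\<Sum>t\<in>{q..<n}. H $$ (s, t) * y0 t)) ?F"
      using s q(1) unfolding y0_def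
      by (intro tendsto_diff rhs_lo tendsto_sum tendsto_mult A z_hi) auto
    then show ?thesis by (simp add: split)
  qed
  obtain \<zeta> where \<zeta>: "\<And>t. t < q \<Longrightarrow> ((\<lambda>e. z e t) \<longlongrightarrow> \<zeta> t) ?F"
    and H\<zeta>: "\<And>s. s < q \<Longrightarrow> (\<Sum>t<q. L $$ (s, t) * \<zeta> t) = 0 - (\<Sum>t\<in>{q..<n}. H $$ (s, t) * y0 t)"
    by (rule tendsto_solve_linear[OF bot L(1,2) _ g]) (use A L(3) q(1) in auto)
  define y where "y t = (if t < q then \<zeta> t else y0 t)" for t
  have zy: "((\<lambda>e. z e t) \<longlongrightarrow> y t) ?F" if "t < n" for t
    using that \<zeta> z_hi by (auto simp: y_def y0_def)
  have Ay: "((\<lambda>e. \<Sum>t<n. A e s t * z e t) \<longlongrightarrow> (\<Sum>t<n. H $$ (s, t) * y t)) ?F" if "s < n" for s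
    using that by (intro tendsto_sum tendsto_mult A zy) auto
  show thesis
  proof (rule that)
    fix s assume s: "s < n"
    show "y s = w s" if "2 * \<mu> s = \<alpha>"
      using q(2)[OF s] that by (simp add: y_def y0_def)
    show "y s = 0" if "2 * \<mu> s > \<alpha>"
      using q(2)[OF s] that by (simp add: y_def y0_def)
    show "w s = 0" if lt: "2 * \<mu> s < \<alpha>"
    proof -
      \<comment> \<open>Undoing the scaling: v is z times a positive power of e, and z has just been
        shown to converge.\<close>
      have "((\<lambda>e. e powr (\<alpha> / 2 - \<mu> s) * z e s) \<longlongrightarrow> 0 * y s) ?F"
        using lt by (intro tendsto_mult tendsto_powr_at_right_0 zy s) auto
      moreover have "\<forall>\<^sub>F e in ?F. e powr (\<alpha> / 2 - \<mu> s) * z e s = v e s"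
        using pos by eventually_elim (simp add: z_def mult.assoc[symmetric] flip: powr_add)
      ultimately have "((\<lambda>e. v e s) \<longlongrightarrow> 0 * y s) ?F"
        by (rule Lim_transform_eventually)
      with v[OF s] show ?thesis using tendsto_unique[OF bot] by fastforce
    qed
    show "(\<Sum>t<n. H $$ (s, t) * y t) = 0" if lt: "2 * \<mu> s < \<alpha>"
      using Ay[OF s] rhs_lo[OF s] q(2)[OF s] lt tendsto_unique[OF bot] by blast
    show "(\<Sum>t<n. H $$ (s, t) * y t) = c * w s" if e: "2 * \<mu> s = \<alpha>"
    proof -
      have "((\<lambda>e. lam e * e powr (-\<alpha>) * (e powr 0 * v e s)) \<longlongrightarrow> c * (1 * w s)) ?F"
        by (intro tendsto_mult lam tendsto_powr_0_at_right_0 v s)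
      moreover have "\<alpha> / 2 - \<mu> s = 0" using e by simp
      ultimately have "((\<lambda>e. \<Sum>t<n. A e s t * z e t) \<longlongrightarrow> c * (1 * w s)) ?F"
        unfolding tendsto_cong[OF eq[OF s]] by simp
      with Ay[OF s] show ?thesis using tendsto_unique[OF bot] by fastforce
    qed
    show "c * w s = 0" if gt: "2 * \<mu> s > \<alpha>"
    proof -
      \<comment> \<open>Here the right-hand side of \<open>eq\<close> carries a negative power of e.
        Multiplying by its reciprocal leaves a quantity with limit c w on one side and a null
        sequence on the other.\<close>
      have "((\<lambda>e. e powr (\<mu> s - \<alpha> / 2) * (\<Sum>t<n. A e s t * z e t)) \<longlongrightarrow> 0 * (\<Sum>t<n. H $$ (s, t) * y t)) ?F"
        using gt by (intro tendsto_mult tendsto_powr_at_right_0 Ay s) auto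
      moreover have "\<forall>\<^sub>F e in ?F. e powr (\<mu> s - \<alpha> / 2) * (\<Sum>t<n. A e s t * z e t) = lam e * e powr (-\<alpha>) * v e s"
        using eq[OF s] pos
      proof eventually_elim
        case (elim e)
        have "e powr (\<mu> s - \<alpha> / 2) * e powr (\<alpha> / 2 - \<mu> s) = 1"
          using elim by (simp flip: powr_add)
        moreover have "a * (l * (b * x)) = a * b * (l * x)" for a b l x :: real
          by (simp only: mult_ac)
        ultimately show ?case unfolding elim(1) by (simp only: mult_1)
      qed
      ultimately have "((\<lambda>e. lam e * e powr (-\<alpha>) * v e s) \<longlongrightarrow> 0 * (\<Sum>t<n. H $$ (s, t) * y t)) ?F"
        by (rule Lim_transform_eventually)
      moreover have "((\<lambda>e. lam e * e powr (-\<alpha>) * v e s) \<longlongrightarrow> c * w s) ?F"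
        by (intro tendsto_mult lam v s)
      ultimately show ?thesis using tendsto_unique[OF bot] by fastforce
    qed
  qed
qed

section \<open>Leading terms of analytic functions\<close>

text \<open>The exponent is the order of vanishing at 0, that is, the subdegree of the expansion.
  Most of the work is to evaluate the definite description in \<open>leading_term\<close>: any
  admissible pair has to be shown equal to the one read off the series.\<close>

lemma analytic_at_0_leading_term:
  assumes "analytic_at_0 f" and nz: "\<not> (\<forall>\<^sub>F x in nhds 0. f x = 0)"
  obtains c and \<alpha> :: nat where "c \<noteq> 0" "((\<lambda>x. f x / x ^ \<alpha>) \<longlongrightarrow> c) (at 0)"
    "\<And>e. leading_term f e = c * e ^ \<alpha>"
proof -
  obtain F where F: "f has_fps_expansion F"
    using assms by (auto simp: analytic_at_0_def)
  have "F \<noteq> 0"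
  proof
    assume "F = 0"
    with F have "\<forall>\<^sub>F x in nhds 0. f x = 0"
      unfolding has_fps_expansion_def by (auto elim!: eventually_mono)
    with nz show False by simp
  qed
  define \<alpha> where "\<alpha> = subdegree F"
  define c where "c = fps_nth F \<alpha>"
  have c: "c \<noteq> 0" using \<open>F \<noteq> 0\<close> by (simp add: c_def \<alpha>_def)
  \<comment> \<open>The quotient has a removable singularity; the value c at 0 makes it a function
    with the shifted series as expansion.\<close>
  define g where "g x = (if x = 0 then c else f x / x ^ \<alpha>)" for x
  have g: "g has_fps_expansion fps_shift \<alpha> F"
    unfolding g_def by (rule has_fps_expansion_shift[OF F]) (auto simp: \<alpha>_def c_def)
  define G where "G = fps_shift \<alpha> F - fps_const c"
  have G: "(\<lambda>x. g x - c) has_fps_expansion G"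
    unfolding G_def by (intro fps_expansion_intros g)
  have G0: "fps_nth G 0 = 0" by (simp add: G_def c_def)
  have lim: "((\<lambda>x. f x / x ^ \<alpha>) \<longlongrightarrow> c) (at 0)"
  proof -
    have "(g \<longlongrightarrow> g 0) (at 0)"
      using has_fps_expansion_imp_continuous[OF g, of UNIV] by (simp add: continuous_within)
    then have "(g \<longlongrightarrow> c) (at 0)" by (simp add: g_def)
    then show ?thesis
      by (rule Lim_transform_eventually) (auto simp: g_def eventually_at_filter)
  qed
  have big: "(\<lambda>x. f x - c * x ^ \<alpha>) \<in> O[at 0](\<lambda>x. x ^ Suc \<alpha>)"
  proof -
    \<comment> \<open>The same division once more, applied to g - c: h is continuous at 0, hence
      bounded nearby, which gives the extra order in the O-term.\<close>
    define h where "h x = (if x = 0 then fps_nth G 1 else (g x - c) / x ^ 1)" for x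
    have "h has_fps_expansion fps_shift 1 G"
    \<comment> \<open>The shift needs subdegree at least 1, but the zero series has subdegree 0. In
      that case g equals c near 0.\<close>
    proof (cases "G = 0")
      case False
      then have "1 \<le> subdegree G" using G0 by (metis One_nat_def Suc_leI bot_nat_0.not_eq_extremum nth_subdegree_nonzero)
      then show ?thesis unfolding h_def by (intro has_fps_expansion_shift[OF G]) auto
    next
      case True
      with G have "\<forall>\<^sub>F x in nhds 0. g x - c = 0"
        unfolding has_fps_expansion_def by (auto elim!: eventually_mono)
      then have "\<forall>\<^sub>F x in nhds 0. h x = 0"
        by eventually_elim (auto simp: h_def True)
      then show ?thesis using True by (auto simp: has_fps_expansion_def elim!: eventually_mono)
    qed
    then have "(h \<longlongrightarrow> h 0) (at 0)"
      using has_fps_expansion_imp_continuous[of h _ UNIV] by (simp add: continuous_within)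
    moreover have "\<forall>\<^sub>F x in at 0. h x = (f x - c * x ^ \<alpha>) / x ^ Suc \<alpha>"
      by (auto simp: h_def g_def eventually_at_filter divide_simps)
    ultimately have "((\<lambda>x. (f x - c * x ^ \<alpha>) / x ^ Suc \<alpha>) \<longlongrightarrow> h 0) (at 0)"
      by (rule Lim_transform_eventually)
    then show ?thesis
      by (rule bigoI_tendsto) (auto simp: eventually_at_filter)
  qed
  have "leading_term f e = c * e ^ \<alpha>" for e
  proof -
    have "y = c * e ^ \<alpha>"
      if "c' \<noteq> 0" "(\<lambda>x. f x - c' * x ^ \<beta>) \<in> O[at 0](\<lambda>x. x ^ Suc \<beta>)" "y = c' * e ^ \<beta>" for y c' and \<beta> :: nat
    proof -
      \<comment> \<open>The O-bound of order \<beta> + 1 is in particular o(x^\<beta>), which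
        identifies c' as a limit of quotients.\<close>
      have lim': "((\<lambda>x. f x / x ^ \<beta>) \<longlongrightarrow> c') (at 0)"
      proof -
        have "(\<lambda>x::real. x ^ Suc \<beta>) \<in> o[at 0](\<lambda>x. x ^ \<beta>)"
        proof (rule smalloI_tendsto)
          show "((\<lambda>x::real. x ^ Suc \<beta> / x ^ \<beta>) \<longlongrightarrow> 0) (at 0)"
            by (rule Lim_transform_eventually[OF tendsto_ident_at]) (auto simp: eventually_at_filter)
          show "\<forall>\<^sub>F x::real in at 0. x ^ \<beta> \<noteq> 0"
            unfolding eventually_at_filter by auto
        qed
        with that(2) have "(\<lambda>x. f x - c' * x ^ \<beta>) \<in> o[at 0](\<lambda>x. x ^ \<beta>)"
          by (rule landau_o.big_small_trans)
        then have "((\<lambda>x. (f x - c' * x ^ \<beta>) / x ^ \<beta> + c') \<longlongrightarrow> 0 + c') (at 0)"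
          by (intro tendsto_add smalloD_tendsto tendsto_const)
        then show ?thesis
          by (auto elim!: Lim_transform_eventually simp: eventually_at_filter diff_divide_distrib)
      qed
      have *: False if lt: "i < j" and "((\<lambda>x. f x / x ^ i) \<longlongrightarrow> d) (at 0)" "((\<lambda>x. f x / x ^ j) \<longlongrightarrow> d') (at 0)" "d \<noteq> 0"
        for i j d d'
      proof -
        \<comment> \<open>A finite limit for the larger exponent j forces the quotient for i to tend
          to 0, against d being nonzero.\<close>
        have "((\<lambda>x. f x / x ^ j * x ^ (j - i)) \<longlongrightarrow> d' * 0 ^ (j - i)) (at 0)"
          by (intro tendsto_mult that tendsto_power tendsto_ident_at)
        moreover have "\<forall>\<^sub>F x in at 0. f x / x ^ j * x ^ (j - i) = f x / x ^ i"
          using lt by (auto simp: eventually_at_filter field_simps simp flip: power_add)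
        ultimately have "((\<lambda>x. f x / x ^ i) \<longlongrightarrow> d' * 0 ^ (j - i)) (at 0)"
          by (rule Lim_transform_eventually)
        then have "d = d' * 0 ^ (j - i)"
          using that(2) tendsto_unique[OF at_neq_bot] by blast
        with lt \<open>d \<noteq> 0\<close> show False by simp
      qed
      have "\<alpha> = \<beta>"
        using *[OF _ lim lim' c] *[OF _ lim' lim that(1)] by (metis linorder_neqE_nat)
      with lim lim' have "c = c'" using tendsto_unique[OF at_neq_bot] by blast
      with \<open>\<alpha> = \<beta>\<close> that(3) show ?thesis by simp
    qed
    then show ?thesis
      unfolding leading_term_def if_not_P[OF nz]
      by (intro the_equality) (use c big in blast)+
  qed
  then show thesis using that c lim by blast
qed

section \<open>Block notions as slices; congruence of Schur complements\<close>

lemma block_eq_slice: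
  assumes "blk_offset r (Suc i) \<le> dim_row M" "blk_offset c (Suc k) \<le> dim_col M"
  shows "block r c M i k =
    slice M (blk_offset r i) (blk_offset r (Suc i)) (blk_offset c k) (blk_offset c (Suc k))"
  unfolding block_def blk_def using assms by (rule submatrix_eq_slice)

lemma block_col_eq_slice:
  assumes "blk_offset a (Suc i) \<le> dim_col M"
  shows "block_col a M i = slice M 0 (dim_row M) (blk_offset a i) (blk_offset a (Suc i))"
  unfolding block_col_def blk_def using assms by (rule submatrix_UNIV_eq_slice)

lemma block_cols_less_eq_slice:
  assumes "blk_offset a i \<le> dim_col M"
  shows "block_cols_less a M i = slice M 0 (dim_row M) 0 (blk_offset a i)"
  unfolding block_cols_less_def blks_less_def lessThan_atLeast0 using assms by (rule submatrix_UNIV_eq_slice)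

lemma leading_blocks_eq_slice:
  assumes "blk_offset a i \<le> dim_row M" "blk_offset a i \<le> dim_col M"
  shows "leading_blocks a M i = slice M 0 (blk_offset a i) 0 (blk_offset a i)"
  unfolding leading_blocks_def blks_less_def lessThan_atLeast0 using assms by (rule submatrix_eq_slice)

lemma block_row_less_eq_slice:
  assumes "blk_offset a (Suc i) \<le> dim_row M" "blk_offset a i \<le> dim_col M"
  shows "block_row_less a M i = slice M (blk_offset a i) (blk_offset a (Suc i)) 0 (blk_offset a i)"
  unfolding block_row_less_def blks_less_def blk_def lessThan_atLeast0 using assms by (rule submatrix_eq_slice)

lemma slice_full: "M \<in> carrier_mat m k \<Longrightarrow> slice M 0 m 0 k = M"
  by (intro eq_matI) auto

text \<open>Telescoping of the rank differences. Subtraction of natural numbers truncates at 0;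
  positivity of each increment guarantees that adding the previous rank back is exact. For j = p
  this gives that the b_i sum to n.\<close>

lemma blk_offset_block_rank_increment:
  assumes V: "V \<in> carrier_mat n (blk_offset a (Suc p))"
    and pos: "\<forall>i\<le>p. block_rank_increment n a V i > 0" and "j \<le> p"
  shows "blk_offset (block_rank_increment n a V) (Suc j) = vec_space.rank n (block_cols_less a V (Suc j))"
  using \<open>j \<le> p\<close>
proof (induction j)
  case 0
  have "block_cols_less a V (Suc 0) = block_col a V 0"
    by (simp add: block_cols_less_def block_col_def blks_less_def blk_def lessThan_atLeast0)
  then show ?case by (simp add: blk_offset_Suc block_rank_increment_def)
next
  case (Suc j)
  have "block_rank_increment n a V (Suc j) > 0" using pos Suc.prems by simp
  then show ?case
    using Suc by (simp add: blk_offset_Suc[of _ "Suc j"]) (simp add: block_rank_increment_def)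
qed

lemma mult_mat_assoc5:
  fixes A :: "'a :: semiring_0 mat"
  assumes "A \<in> carrier_mat n1 n2" "B \<in> carrier_mat n2 n3" "G \<in> carrier_mat n3 n4"
    "B' \<in> carrier_mat n4 n5" "A' \<in> carrier_mat n5 n6"
  shows "A * B * G * (B' * A') = A * (B * G * B') * A'"
proof -
  have "A * B * G * (B' * A') = A * (B * G) * (B' * A')"
    using assms by simp
  also have "\<dots> = A * ((B * G) * (B' * A'))"
    using assms by (intro assoc_mult_mat[of _ n1 n2 _ n4 _ n6]) auto
  also have "(B * G) * (B' * A') = (B * G * B') * A'"
    using assms by (intro assoc_mult_mat[symmetric, of _ n2 n4 _ n5 _ n6]) auto
  also have "A * ((B * G * B') * A') = A * (B * G * B') * A'"
    using assms by (intro assoc_mult_mat[symmetric, of _ n1 n2 _ n5 _ n6]) auto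
  finally show ?thesis .
qed

text \<open>\<open>L\<close> is square and the determinant condition makes it invertible, so
  \<open>L\<^sup>T * (L * W * L\<^sup>T)\<close>^-1 \<open>* L\<close> is the inverse of
  \<open>W\<close>, and the factors \<open>L\<close> disappear from the correction term.
  \<open>P\<close> may be rectangular and is simply pulled out.\<close>

lemma schur_complement_congruence:
  fixes L :: "real mat"
  assumes L: "L \<in> carrier_mat q q" and W: "W \<in> carrier_mat q q" and P: "P \<in> carrier_mat r k"
    and C: "C \<in> carrier_mat k q" and Y: "Y \<in> carrier_mat k k"
    and det: "det (L * W * L\<^sup>T) \<noteq> 0"
  shows "det W \<noteq> 0"
    and "P * Y * P\<^sup>T - (P * C * L\<^sup>T) * the (mat_inverse (L * W * L\<^sup>T)) * (P * C * L\<^sup>T)\<^sup>T =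
      P * (Y - C * the (mat_inverse W) * C\<^sup>T) * P\<^sup>T"
proof -
  let ?G = "the (mat_inverse (L * W * L\<^sup>T))" and ?X = "the (mat_inverse W)"
  have "det (L * W * L\<^sup>T) = det L * det W * det L"
    using L W by (simp add: det_mult[of _ q] det_transpose)
  with det show detW: "det W \<noteq> 0" by auto
  have "L * W * L\<^sup>T \<in> carrier_mat q q" using L W by simp
  note G = the_mat_inverse[OF this det]
  note X = the_mat_inverse[OF W detW]
  note [simp] = L W P C Y G(1) X(1) mult_carrier_mat[of _ q q _ q] mult_carrier_mat[of _ k q _ q]
    mult_carrier_mat[of _ k q _ k] mult_carrier_mat[of _ r k _ k]
  have "L * (W * (L\<^sup>T * M)) = L * W * L\<^sup>T * M" if "M \<in> carrier_mat q q" for M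
    using that by (simp add: assoc_mult_mat[of _ q q _ q _ q])
  from this[OF G(1)] have "L * (W * (L\<^sup>T * ?G)) = 1\<^sub>m q" using G(2) by simp
  \<comment> \<open>For square matrices a right inverse of \<open>L\<close> is also a left inverse.
    Multiplying by the inverse of \<open>W\<close> from the left then isolates
    \<open>L\<^sup>T * ?G * L\<close>.\<close>
  then have "W * (L\<^sup>T * ?G) * L = 1\<^sub>m q"
    by (rule mat_mult_left_right_inverse[rotated 2]) auto
  moreover have "W * (L\<^sup>T * M) * L = W * (L\<^sup>T * M * L)"
    and "?X * (W * (L\<^sup>T * M * L)) = ?X * W * (L\<^sup>T * M * L)" if "M \<in> carrier_mat q q" for M
    using that by (simp_all add: assoc_mult_mat[of _ q q _ q _ q])
  note this[OF G(1)]
  ultimately have "?X * W * (L\<^sup>T * ?G * L) = ?X * 1\<^sub>m q" by metis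
  then have X_eq: "L\<^sup>T * ?G * L = ?X" using X(3) by (simp add: left_mult_one_mat[of _ q q] right_mult_one_mat[of _ q q])
  have assoc: "P * C * L\<^sup>T = P * (C * L\<^sup>T)"
    by (intro assoc_mult_mat[of _ r k _ q _ q]) auto
  have "(P * (C * L\<^sup>T))\<^sup>T = (C * L\<^sup>T)\<^sup>T * P\<^sup>T"
    by (intro transpose_mult[of _ r k _ q]) auto
  moreover have CL: "(C * L\<^sup>T)\<^sup>T = L * C\<^sup>T"
    by (subst transpose_mult[of _ k q _ q]) auto
  ultimately have "(P * C * L\<^sup>T) * ?G * (P * C * L\<^sup>T)\<^sup>T = P * (C * L\<^sup>T) * ?G * ((C * L\<^sup>T)\<^sup>T * P\<^sup>T)"
    unfolding assoc by simp
  also have "\<dots> = P * (C * L\<^sup>T * ?G * (C * L\<^sup>T)\<^sup>T) * P\<^sup>T"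
    by (intro mult_mat_assoc5[of _ r k _ q _ q _ k _ r]) auto
  also have "C * L\<^sup>T * ?G * (C * L\<^sup>T)\<^sup>T = C * ?X * C\<^sup>T"
    unfolding CL X_eq[symmetric] by (intro mult_mat_assoc5[of _ k q _ q _ q _ q _ k]) auto
  finally have eq: "(P * C * L\<^sup>T) * ?G * (P * C * L\<^sup>T)\<^sup>T = P * (C * ?X * C\<^sup>T) * P\<^sup>T" .
  have Z: "C * ?X * C\<^sup>T \<in> carrier_mat k k" by auto
  have "P * (Y - C * ?X * C\<^sup>T) * P\<^sup>T = (P * Y - P * (C * ?X * C\<^sup>T)) * P\<^sup>T"
    using Z by (simp add: mult_minus_distrib_mat[of _ r k _ k])
  also have "\<dots> = P * Y * P\<^sup>T - P * (C * ?X * C\<^sup>T) * P\<^sup>T"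
    using Z by (intro minus_mult_distrib_mat[of _ r k _ _ r]) auto
  finally show "P * Y * P\<^sup>T - (P * C * L\<^sup>T) * ?G * (P * C * L\<^sup>T)\<^sup>T =
      P * (Y - C * ?X * C\<^sup>T) * P\<^sup>T" unfolding eq ..
qed

section \<open>Eigenvectors of graded matrices\<close>

lemma sum_lessThan_add: "(\<Sum>t<q + k. f t) = (\<Sum>t<q. f t) + (\<Sum>t<k. f (q + t :: nat))"
  for f :: "nat \<Rightarrow> 'a :: comm_monoid_add"
  by (induction k) (simp_all add: add.assoc)

text \<open>Block elimination: with y split into the part \<open>yl\<close> before block m and the
  part \<open>ym\<close> on it, the vanishing rows say \<open>Hml\<^sup>T *\<^sub>v ym\<close> = -
  \<open>Hll *\<^sub>v yl\<close>. Applying \<open>Hml\<close> times the inverse of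
  \<open>Hll\<close> turns the correction term of the Schur complement into -
  \<open>Hml *\<^sub>v yl\<close>.\<close>

lemma block_schur_slice:
  assumes H: "H \<in> carrier_mat n n" and le: "blk_offset b (Suc m) \<le> n" and sym: "H\<^sup>T = H"
    and det: "det (slice H 0 (blk_offset b m) 0 (blk_offset b m)) \<noteq> 0"
    and lo: "\<And>s. s < blk_offset b m \<Longrightarrow> (\<Sum>t<blk_offset b (Suc m). H $$ (s, t) * y t) = 0"
  shows "block_schur b H m \<in> carrier_mat (b m) (b m)"
    and "block_schur b H m *\<^sub>v vec (b m) (\<lambda>t. y (blk_offset b m + t)) =
      vec (b m) (\<lambda>s. \<Sum>t<blk_offset b (Suc m). H $$ (blk_offset b m + s, t) * y t)"
proof -
  define q where "q = blk_offset b m"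
  define q' where "q' = blk_offset b (Suc m)"
  have q': "q' = q + b m" by (simp add: q_def q'_def blk_offset_Suc)
  have le': "q' \<le> n" "q \<le> n" using le by (auto simp: q' q'_def[symmetric])
  define yl where "yl = vec q y"
  define ym where "ym = vec (b m) (\<lambda>t. y (q + t))"
  define Hmm where "Hmm = slice H q q' q q'"
  define Hml where "Hml = slice H q q' 0 q"
  define Hll where "Hll = slice H 0 q 0 q"
  have c [simp]: "yl \<in> carrier_vec q" "ym \<in> carrier_vec (b m)" "Hmm \<in> carrier_mat (b m) (b m)"
    "Hml \<in> carrier_mat (b m) q" "Hll \<in> carrier_mat q q"
    using q' slice_carrier[of H] by (auto simp: yl_def ym_def Hmm_def Hml_def Hll_def)
  have rows: "slice H r r' 0 q *\<^sub>v yl + slice H r r' q q' *\<^sub>v ym =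
    vec (r' - r) (\<lambda>s. \<Sum>t<q'. H $$ (r + s, t) * y t)" for r r'
    by (rule eq_vecI)
       (auto simp: sum_lessThan_add q' yl_def ym_def scalar_prod_def atLeast0LessThan intro!: sum.cong arg_cong2[where f = "(+)"])
  have Hlm: "slice H 0 q q q' = Hml\<^sup>T"
    unfolding Hml_def using slice_transpose[where M = H and r = q and r' = q' and c = 0 and c' = q] H le' sym by simp
  have row_m: "Hml *\<^sub>v yl + Hmm *\<^sub>v ym = vec (b m) (\<lambda>s. \<Sum>t<q'. H $$ (q + s, t) * y t)"
    using rows[of q q'] by (simp add: Hmm_def Hml_def q')
  have row_l: "Hll *\<^sub>v yl + Hml\<^sup>T *\<^sub>v ym = 0\<^sub>v q"
    using rows[of 0 q] lo unfolding Hlm Hll_def[symmetric]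
    by (auto simp: q_def q'_def)
  have "block_schur b H m \<in> carrier_mat (b m) (b m) \<and>
    block_schur b H m *\<^sub>v ym = Hml *\<^sub>v yl + Hmm *\<^sub>v ym"
  \<comment> \<open>\<open>block_schur\<close> has no correction term at 0; then \<open>yl\<close>
    is the empty vector.\<close>
  proof (cases "m = 0")
    case True
    then have "q = 0" by (simp add: q_def)
    have "block_schur b H m = Hmm"
      using H le True block_eq_slice[of b m H b m] by (simp add: block_schur_def Hmm_def q_def q'_def)
    moreover have "Hml *\<^sub>v yl = 0\<^sub>v (b m)"
      using \<open>q = 0\<close> c(1,4) by (auto simp: scalar_prod_def intro!: eq_vecI)
    ultimately show ?thesis using c by (auto simp: left_zero_vec[of _ "b m"] mult_mat_vec_carrier[of _ "b m" "b m"])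
  next
    case False
    define G where "G = the (mat_inverse Hll)"
    have G: "G \<in> carrier_mat q q" "G * Hll = 1\<^sub>m q"
      using the_mat_inverse[OF c(5)] det unfolding G_def by (simp_all add: Hll_def q_def)
    have S: "block_schur b H m = Hmm - Hml * G * Hml\<^sup>T"
      using False H le le' unfolding block_schur_def
      by (simp add: block_eq_slice block_row_less_eq_slice leading_blocks_eq_slice q_def[symmetric] q'_def[symmetric]
          Hmm_def Hml_def Hll_def G_def)
    have [simp]: "Hml\<^sup>T *\<^sub>v ym \<in> carrier_vec q" "Hll *\<^sub>v yl \<in> carrier_vec q"
      "Hmm *\<^sub>v ym \<in> carrier_vec (b m)" "Hml *\<^sub>v yl \<in> carrier_vec (b m)"
      by (rule carrier_vecI, simp add: carrier_matD[OF c(3)] carrier_matD[OF c(4)] carrier_matD[OF c(5)])+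
    have HG: "Hml * G \<in> carrier_mat (b m) q" "Hml * G * Hml\<^sup>T \<in> carrier_mat (b m) (b m)"
      using G by (simp_all add: mult_carrier_mat[of _ "b m" q])
    have "Hml\<^sup>T *\<^sub>v ym = - (Hll *\<^sub>v yl)"
    proof (rule eq_vecI)
      fix i assume "i < dim_vec (- (Hll *\<^sub>v yl))"
      then have i: "i < q" by (simp add: carrier_matD[OF c(5)])
      have "vec_index (Hll *\<^sub>v yl + Hml\<^sup>T *\<^sub>v ym) i = 0" using row_l i by simp
      then have "vec_index (Hll *\<^sub>v yl) i + vec_index (Hml\<^sup>T *\<^sub>v ym) i = 0"
        using i by (subst (asm) index_add_vec(1)) (simp_all add: carrier_matD[OF c(4)])
      then show "vec_index (Hml\<^sup>T *\<^sub>v ym) i = vec_index (- (Hll *\<^sub>v yl)) i"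
        using i by (subst index_uminus_vec(1)) (simp_all add: carrier_matD[OF c(5)])
    qed (simp add: carrier_matD[OF c(4)] carrier_matD[OF c(5)])
    then have "Hml * G * Hml\<^sup>T *\<^sub>v ym = Hml * G *\<^sub>v (- (Hll *\<^sub>v yl))"
      using HG by (simp add: assoc_mult_mat_vec[of _ "b m" q _ "b m"])
    also have "\<dots> = - (Hml *\<^sub>v yl)"
    proof -
      have "Hml * G *\<^sub>v (- (Hll *\<^sub>v yl)) = - (Hml * G *\<^sub>v (Hll *\<^sub>v yl))"
        using HG by (intro eq_vecI) (auto simp: carrier_matD[OF c(5)] carrier_matD[OF G(1)])
      also have "Hml * G *\<^sub>v (Hll *\<^sub>v yl) = Hml *\<^sub>v (G *\<^sub>v (Hll *\<^sub>v yl))"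
        using G by (intro assoc_mult_mat_vec[of _ "b m" q _ q]) auto
      also have "G *\<^sub>v (Hll *\<^sub>v yl) = G * Hll *\<^sub>v yl"
        using G by (intro assoc_mult_mat_vec[symmetric, of _ q q _ q]) auto
      finally show ?thesis using G(2) by simp
    qed
    finally have "Hml * G * Hml\<^sup>T *\<^sub>v ym = - (Hml *\<^sub>v yl)" .
    then have "block_schur b H m *\<^sub>v ym = Hmm *\<^sub>v ym - - (Hml *\<^sub>v yl)"
      unfolding S using HG by (simp add: minus_mult_distrib_mat_vec[of _ "b m" "b m"])
    also have "\<dots> = Hml *\<^sub>v yl + Hmm *\<^sub>v ym"
      by (intro eq_vecI) (auto simp: carrier_matD[OF c(3)] carrier_matD[OF c(4)])
    finally show ?thesis unfolding S using minus_carrier_mat[OF HG(2)] by blast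
  qed
  with row_m show "block_schur b H m \<in> carrier_mat (b m) (b m)"
    "block_schur b H m *\<^sub>v vec (b m) (\<lambda>t. y (blk_offset b m + t)) =
      vec (b m) (\<lambda>s. \<Sum>t<blk_offset b (Suc m). H $$ (blk_offset b m + s, t) * y t)"
    by (simp_all add: ym_def q_def q'_def)
qed

text \<open>The analysis of a single eigenpair: \<open>w\<close> plays the role of
  \<open>Q\<^sup>T u(0)\<close>. That \<open>w\<close> is not zero both excludes an identically
  vanishing eigenvalue and singles out the block m.\<close>

lemma graded_eigenvector_limit:
  fixes B :: "real \<Rightarrow> real mat" and v :: "real \<Rightarrow> nat \<Rightarrow> real" and \<nu> :: "nat \<Rightarrow> real"
  assumes \<nu>: "strict_mono_on {..p} \<nu>" and n: "blk_offset b (Suc p) = n"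
    and H: "H \<in> carrier_mat n n" and sym: "H\<^sup>T = H"
    and lead: "\<And>i. i \<le> Suc p \<Longrightarrow> det (slice H 0 (blk_offset b i) 0 (blk_offset b i)) \<noteq> 0"
    and B: "entries_tendsto B H n n (at_right 0)"
    and v: "\<And>s. s < n \<Longrightarrow> ((\<lambda>e. v e s) \<longlongrightarrow> w s) (at_right 0)"
    and w: "\<exists>s<n. w s \<noteq> 0"
    and lam: "analytic_at_0 lam"
    and eig: "\<forall>\<^sub>F e in at_right 0. \<forall>s<n.
      (\<Sum>t<n. e powr (\<nu> (blk_index b s) + \<nu> (blk_index b t)) * B e $$ (s, t) * v e t) = lam e * v e s"
  obtains m c where "m \<le> p" "\<And>e. e > 0 \<Longrightarrow> leading_term lam e = c * e powr (2 * \<nu> m)"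
    "\<And>s. s < n \<Longrightarrow> blk_index b s \<noteq> m \<Longrightarrow> w s = 0"
    "block_schur b H m *\<^sub>v vec (b m) (\<lambda>t. w (blk_offset b m + t)) =
      c \<cdot>\<^sub>v vec (b m) (\<lambda>t. w (blk_offset b m + t))"
proof -
  let ?F = "at_right (0::real)"
  define \<mu> where "\<mu> s = \<nu> (blk_index b s)" for s
  have less_iff: "\<nu> i < \<nu> j \<longleftrightarrow> i < j" if "i \<le> p" "j \<le> p" for i j
    using strict_mono_on_less[OF \<nu>] that by simp
  have idx: "blk_index b s \<le> p" "blk_index b s < i \<longleftrightarrow> s < blk_offset b i" if "s < n" for s i
    using blk_index_bounds(3)[of s b "Suc p"] blk_index_less_iff[of s b "Suc p" i] that n by auto
  have off: "blk_offset b i \<le> n" if "i \<le> Suc p" for i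
    using blk_offset_mono[OF that, of b] n by simp
  have ev_eig: "\<forall>\<^sub>F e in ?F. \<forall>s<n. (\<Sum>t<n. e powr (\<mu> s + \<mu> t) * B e $$ (s, t) * v e t) = lam e * v e s"
    using eig unfolding \<mu>_def .
  have Bl: "((\<lambda>e. B e $$ (s, t)) \<longlongrightarrow> H $$ (s, t)) ?F" if "s < n" "t < n" for s t
    using B that by (auto simp: entries_tendsto_def)
  \<comment> \<open>An eigenvalue vanishing near 0 may be given any exponent, with c = 0. The choice
    2 \<nu> p + 1 exceeds every 2 \<mu> s, so all rows are low, q = n, L = H, and \<open>w\<close>
    would be 0.\<close>
  have "\<not> (\<forall>\<^sub>F x in nhds 0. lam x = 0)"
  proof
    assume "\<forall>\<^sub>F x in nhds 0. lam x = 0"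
    then have "\<forall>\<^sub>F x in ?F. lam x = 0"
      unfolding eventually_at_filter by (auto elim: eventually_mono)
    then have lim0: "((\<lambda>e. lam e * e powr (- (2 * \<nu> p + 1))) \<longlongrightarrow> 0) ?F"
      by (intro tendsto_eventually) (auto elim: eventually_mono)
    have lt: "2 * \<mu> s < 2 * \<nu> p + 1" if "s < n" for s
      using less_iff[of p "blk_index b s"] idx(1)[OF that] unfolding \<mu>_def by fastforce
    have "w s = 0" if "s < n" for s
    proof (rule scaled_eigenvector_limit[OF Bl v lim0 ev_eig, where q = n and L = H])
      show "det H \<noteq> 0" using lead[of "Suc p"] slice_full[OF H] n by simp
    qed (use H lt that in auto)
    with w show False by blast
  qed
  then obtain c and \<alpha> :: nat where c: "c \<noteq> 0" and lim: "((\<lambda>x. lam x / x ^ \<alpha>) \<longlongrightarrow> c) (at 0)"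
    and lt: "\<And>e. leading_term lam e = c * e ^ \<alpha>"
    by (rule analytic_at_0_leading_term[OF lam]) blast
  have lim': "((\<lambda>e. lam e * e powr (- real \<alpha>)) \<longlongrightarrow> c) ?F"
  proof (rule Lim_transform_eventually)
    show "((\<lambda>x. lam x / x ^ \<alpha>) \<longlongrightarrow> c) ?F"
      using lim by (rule tendsto_within_subset) auto
    show "\<forall>\<^sub>F x in ?F. lam x / x ^ \<alpha> = lam x * x powr (- real \<alpha>)"
      using eventually_pos_at_right_0
      by eventually_elim (simp add: powr_minus powr_realpow divide_inverse)
  qed
  \<comment> \<open>The first block with 2 \<nu> k \<ge> \<alpha>, or \<open>Suc p\<close> if there
    is none. As \<nu> increases, the low indices form an initial segment, so the matrix to be
    inverted in the limit is a leading block of \<open>H\<close>.\<close>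
  define k where "k = (LEAST i. i > p \<or> \<not> 2 * \<nu> i < \<alpha>)"
  have k: "k \<le> Suc p" unfolding k_def by (rule Least_le) simp
  have k_iff: "i < k \<longleftrightarrow> 2 * \<nu> i < \<alpha>" if "i \<le> p" for i
  proof
    assume "i < k"
    then show "2 * \<nu> i < \<alpha>" using not_less_Least[of i "\<lambda>i. i > p \<or> \<not> 2 * \<nu> i < \<alpha>"] by (auto simp: k_def)
  next
    assume i: "2 * \<nu> i < \<alpha>"
    have "k > p \<or> \<not> 2 * \<nu> k < \<alpha>" unfolding k_def by (rule LeastI[of _ "Suc p"]) simp
    with i that less_iff[of i k] less_iff[of k i] show "i < k" by fastforce
  qed
  obtain y where
    y_mid: "\<And>s. s < n \<Longrightarrow> 2 * \<mu> s = \<alpha> \<Longrightarrow> y s = w s" and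
    y_hi: "\<And>s. s < n \<Longrightarrow> 2 * \<mu> s > \<alpha> \<Longrightarrow> y s = 0" and
    w_lo: "\<And>s. s < n \<Longrightarrow> 2 * \<mu> s < \<alpha> \<Longrightarrow> w s = 0" and
    Hy_lo: "\<And>s. s < n \<Longrightarrow> 2 * \<mu> s < \<alpha> \<Longrightarrow> (\<Sum>t<n. H $$ (s, t) * y t) = 0" and
    Hy_mid: "\<And>s. s < n \<Longrightarrow> 2 * \<mu> s = \<alpha> \<Longrightarrow> (\<Sum>t<n. H $$ (s, t) * y t) = c * w s" and
    w_hi: "\<And>s. s < n \<Longrightarrow> 2 * \<mu> s > \<alpha> \<Longrightarrow> c * w s = 0"
  proof (rule scaled_eigenvector_limit[OF Bl v lim' ev_eig, where q = "blk_offset b k"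
        and L = "slice H 0 (blk_offset b k) 0 (blk_offset b k)"])
    show "s < blk_offset b k \<longleftrightarrow> 2 * \<mu> s < \<alpha>" if "s < n" for s
      using k_iff[of "blk_index b s"] idx[OF that] by (auto simp: \<mu>_def)
    show "slice H 0 (blk_offset b k) 0 (blk_offset b k) \<in> carrier_mat (blk_offset b k) (blk_offset b k)"
      using slice_carrier[of H 0 "blk_offset b k" 0] by simp
  qed (use lead[OF k] off[OF k] in auto)
  obtain s0 where s0: "s0 < n" "w s0 \<noteq> 0" using w by blast
  define m where "m = blk_index b s0"
  have m: "m \<le> p" using idx s0 by (simp add: m_def)
  \<comment> \<open>Either strict inequality would make the entry \<open>w s0\<close> vanish, using
    c \<noteq> 0 in the upper case.\<close>
  have \<alpha>: "2 * \<nu> m = \<alpha>"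
    using w_lo[OF s0(1)] w_hi[OF s0(1)] s0 c unfolding \<mu>_def m_def by fastforce
  have \<mu>_iff: "2 * \<mu> s < \<alpha> \<longleftrightarrow> blk_index b s < m" "2 * \<mu> s = \<alpha> \<longleftrightarrow> blk_index b s = m"
    "2 * \<mu> s > \<alpha> \<longleftrightarrow> blk_index b s > m" if "s < n" for s
    using less_iff[of "blk_index b s" m] less_iff[of m "blk_index b s"] m idx(1)[OF that] \<alpha>
    unfolding \<mu>_def by force+
  \<comment> \<open>The limit y vanishes on all blocks after m, so the equations for
    \<open>H\<close> become equations for its part up to block m, the form needed for
    elimination.\<close>
  have trunc: "(\<Sum>t<n. H $$ (s, t) * y t) = (\<Sum>t<blk_offset b (Suc m). H $$ (s, t) * y t)" for s
  proof (intro sum.mono_neutral_right ballI)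
    fix t assume "t \<in> {..<n} - {..<blk_offset b (Suc m)}"
    then show "H $$ (s, t) * y t = 0"
      using idx(2)[of t "Suc m"] y_hi[of t] \<mu>_iff(3)[of t] by auto
  qed (use off[of "Suc m"] m in auto)
  have blk_m: "blk_offset b m + t < n \<and> blk_index b (blk_offset b m + t) = m" if "t < b m" for t
    using that off[of "Suc m"] m by (auto intro!: blk_index_eq simp: blk_offset_Suc)
  show thesis
  proof (rule that[OF m])
    fix e :: real assume "e > 0"
    then show "leading_term lam e = c * e powr (2 * \<nu> m)"
      by (simp add: lt \<alpha> powr_realpow)
  next
    fix s assume "s < n" "blk_index b s \<noteq> m"
    then show "w s = 0" using w_lo w_hi c \<mu>_iff by (metis linorder_neqE_nat mult_eq_0_iff)
  next
    have "block_schur b H m *\<^sub>v vec (b m) (\<lambda>t. y (blk_offset b m + t)) =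
      vec (b m) (\<lambda>s. \<Sum>t<blk_offset b (Suc m). H $$ (blk_offset b m + s, t) * y t)"
    proof (rule block_schur_slice(2)[OF H _ sym])
      fix s assume "s < blk_offset b m"
      moreover have "s < n" using calculation off[of m] m by simp
      ultimately show "(\<Sum>t<blk_offset b (Suc m). H $$ (s, t) * y t) = 0"
        using Hy_lo[of s] \<mu>_iff(1) idx(2)[of s m] by (simp add: trunc)
    qed (use off lead m in auto)
    moreover have "vec (b m) (\<lambda>t. y (blk_offset b m + t)) = vec (b m) (\<lambda>t. w (blk_offset b m + t))"
      using blk_m y_mid \<mu>_iff by (intro eq_vecI) auto
    moreover have "vec (b m) (\<lambda>s. \<Sum>t<blk_offset b (Suc m). H $$ (blk_offset b m + s, t) * y t) =
      c \<cdot>\<^sub>v vec (b m) (\<lambda>t. w (blk_offset b m + t))"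
      using blk_m Hy_mid \<mu>_iff by (intro eq_vecI) (auto simp: trunc)
    ultimately show "block_schur b H m *\<^sub>v vec (b m) (\<lambda>t. w (blk_offset b m + t)) =
      c \<cdot>\<^sub>v vec (b m) (\<lambda>t. w (blk_offset b m + t))" by simp
  qed
qed

section \<open>Spectral sums\<close>

text \<open>The matrix with columns \<open>u k\<close> is orthogonal, hence can be cancelled from T
  U = A U.\<close>

lemma mat_eq_if_agree_on_orthonormal:
  fixes u :: "nat \<Rightarrow> real vec"
  assumes T: "T \<in> carrier_mat n n" "A \<in> carrier_mat n n"
    and u: "\<And>k. k < n \<Longrightarrow> u k \<in> carrier_vec n"
    and orth: "\<And>k l. k < n \<Longrightarrow> l < n \<Longrightarrow> scalar_prod (u k) (u l) = (if k = l then 1 else 0)"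
    and eq: "\<And>k. k < n \<Longrightarrow> T *\<^sub>v u k = A *\<^sub>v u k"
  shows "T = A"
proof -
  define U where "U = mat_of_cols n (map u [0..<n])"
  have U: "U \<in> carrier_mat n n" using mat_of_cols_carrier(1)[of n "map u [0..<n]"] by (simp add: U_def)
  have colU: "col U k = u k" if "k < n" for k
    using that u by (simp add: U_def)
  have "U\<^sup>T * U = 1\<^sub>m n"
    using U by (intro eq_matI) (auto simp: colU orth)
  then have inv: "U * U\<^sup>T = 1\<^sub>m n"
    by (rule mat_mult_left_right_inverse[rotated 2]) (use U in auto)
  have TU: "T * U = A * U"
  proof (rule mat_col_eqI)
    fix k assume "k < dim_col (A * U)"
    then have k: "k < n" using U by simp
    show "col (T * U) k = col (A * U) k"
      unfolding col_mult2[OF T(1) U k] col_mult2[OF T(2) U k] colU[OF k] by (rule eq[OF k])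
  qed (use T U in auto)
  have "T = T * U * U\<^sup>T"
    using T U inv by (simp add: assoc_mult_mat[of _ n n _ n _ n])
  also have "\<dots> = A * U * U\<^sup>T" by (simp add: TU)
  also have "\<dots> = A"
    using T U inv by (simp add: assoc_mult_mat[of _ n n _ n _ n])
  finally show ?thesis .
qed

lemma mat_sum_carrier [simp]: "mat_sum n F I \<in> carrier_mat n n"
  by (simp add: mat_sum_def)

lemma mat_sum_mult_vec:
  assumes F: "\<And>i. i \<in> I \<Longrightarrow> F i \<in> carrier_mat n n" and x: "x \<in> carrier_vec n"
  shows "mat_sum n F I *\<^sub>v x = vec n (\<lambda>s. \<Sum>i\<in>I. vec_index (F i *\<^sub>v x) s)"
proof (rule eq_vecI)
  fix s assume "s < dim_vec (vec n (\<lambda>s. \<Sum>i\<in>I. vec_index (F i *\<^sub>v x) s))"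
  then have s: "s < n" by simp
  have "vec_index (mat_sum n F I *\<^sub>v x) s = (\<Sum>t<n. (\<Sum>i\<in>I. F i $$ (s, t)) * vec_index x t)"
    using s x by (auto simp: mat_sum_def scalar_prod_def atLeast0LessThan intro!: sum.cong)
  also have "\<dots> = (\<Sum>i\<in>I. \<Sum>t<n. F i $$ (s, t) * vec_index x t)"
    unfolding sum_distrib_right by (rule sum.swap)
  also have "\<dots> = (\<Sum>i\<in>I. vec_index (F i *\<^sub>v x) s)"
  proof (rule sum.cong)
    fix i assume "i \<in> I"
    from carrier_matD[OF F[OF this]] show "(\<Sum>t<n. F i $$ (s, t) * vec_index x t) = vec_index (F i *\<^sub>v x) s"
      using s x by (auto simp: scalar_prod_def atLeast0LessThan intro!: sum.cong)
  qed simp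
  finally show "vec_index (mat_sum n F I *\<^sub>v x) s = vec_index (vec n (\<lambda>s. \<Sum>i\<in>I. vec_index (F i *\<^sub>v x) s)) s"
    using s by simp
qed (simp add: mat_sum_def)

lemma ase_mult_eigenvector:
  assumes u: "\<And>k. k < n \<Longrightarrow> u k 0 \<in> carrier_vec n"
    and orth: "\<And>k l. k < n \<Longrightarrow> l < n \<Longrightarrow> scalar_prod (u k 0) (u l 0) = (if k = l then 1 else 0)"
    and l: "l < n"
  shows "ase n lam u e *\<^sub>v u l 0 = leading_term (lam l) e \<cdot>\<^sub>v u l 0"
proof -
  define P where "P k = (let U = mat_of_cols n [u k 0] in leading_term (lam k) e \<cdot>\<^sub>m (U * U\<^sup>T))" for k
  have P: "P k \<in> carrier_mat n n" for k
    by (rule carrier_matI) (simp_all add: P_def Let_def)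
  have Pu: "P k *\<^sub>v u l 0 = (if k = l then leading_term (lam l) e \<cdot>\<^sub>v u l 0 else 0\<^sub>v n)" if k: "k < n" for k
  proof -
    define U where "U = mat_of_cols n [u k 0]"
    have U: "U \<in> carrier_mat n 1" using mat_of_cols_carrier(1)[of n "[u k 0]"] by (simp add: U_def)
    have UTu: "U\<^sup>T *\<^sub>v u l 0 = vec 1 (\<lambda>_. if k = l then 1 else 0)"
      using orth[OF k l] u[OF k] by (intro eq_vecI) (auto simp: U_def)
    have UU: "U * U\<^sup>T \<in> carrier_mat n n" using U by simp
    have "P k *\<^sub>v u l 0 = leading_term (lam k) e \<cdot>\<^sub>v (U * U\<^sup>T *\<^sub>v u l 0)"
      using UU u[OF l] by (intro eq_vecI) (auto simp: P_def Let_def U_def[symmetric])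
    also have "U * U\<^sup>T *\<^sub>v u l 0 = U *\<^sub>v vec 1 (\<lambda>_. if k = l then 1 else 0)"
      unfolding UTu[symmetric] using U u[OF l] by (intro assoc_mult_mat_vec[of _ n 1 _ n]) auto
    also have "\<dots> = (if k = l then u l 0 else 0\<^sub>v n)"
      using u[OF k] by (intro eq_vecI) (auto simp: U_def scalar_prod_def mat_of_cols_def)
    finally show ?thesis by (auto intro!: eq_vecI)
  qed
  have "ase n lam u e *\<^sub>v u l 0 = vec n (\<lambda>s. \<Sum>k<n. vec_index (P k *\<^sub>v u l 0) s)"
    unfolding ase_def P_def[symmetric] using P u[OF l] by (intro mat_sum_mult_vec) auto
  also have "\<dots> = leading_term (lam l) e \<cdot>\<^sub>v u l 0"
  proof (rule eq_vecI)
    fix s assume "s < dim_vec (leading_term (lam l) e \<cdot>\<^sub>v u l 0)"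
    then have s: "s < n" using u[OF l] by simp
    have "(\<Sum>k<n. vec_index (P k *\<^sub>v u l 0) s) =
      (\<Sum>k<n. if k = l then vec_index (leading_term (lam l) e \<cdot>\<^sub>v u l 0) s else 0)"
      using s by (intro sum.cong) (auto simp: Pu)
    then show "vec_index (vec n (\<lambda>s. \<Sum>k<n. vec_index (P k *\<^sub>v u l 0) s)) s =
      vec_index (leading_term (lam l) e \<cdot>\<^sub>v u l 0) s"
      using s l by (simp add: sum.delta)
  qed (use u[OF l] in simp)
  finally show ?thesis .
qed

text \<open>The support condition places x in the range of Q_m:
  \<open>(block_col b Q i)\<^sup>T\<close> kills x for i \<noteq> m, while Q_m applied to the m-th
  coordinates returns x. Only the m-th summand acts, through an eigenvector of
  \<open>S m\<close>.\<close>

lemma block_sum_mult_eigenvector: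
  fixes Q :: "real mat" and x :: "real vec"
  assumes n: "blk_offset b (Suc p) = n" and Q: "Q \<in> carrier_mat n n" "Q\<^sup>T * Q = 1\<^sub>m n"
    and x: "x \<in> carrier_vec n" and S: "\<And>i. i \<le> p \<Longrightarrow> S i \<in> carrier_mat (b i) (b i)"
    and m: "m \<le> p"
    and supp: "\<And>s. s < n \<Longrightarrow> blk_index b s \<noteq> m \<Longrightarrow> vec_index (Q\<^sup>T *\<^sub>v x) s = 0"
    and eig: "S m *\<^sub>v vec (b m) (\<lambda>t. vec_index (Q\<^sup>T *\<^sub>v x) (blk_offset b m + t)) =
      c \<cdot>\<^sub>v vec (b m) (\<lambda>t. vec_index (Q\<^sup>T *\<^sub>v x) (blk_offset b m + t))"
  shows "mat_sum n (\<lambda>i. f i \<cdot>\<^sub>m (block_col b Q i * S i * (block_col b Q i)\<^sup>T)) {..p} *\<^sub>v x = (f m * c) \<cdot>\<^sub>v x"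
proof -
  define w where "w = Q\<^sup>T *\<^sub>v x"
  have w: "w \<in> carrier_vec n" using Q x by (auto simp: w_def intro!: mult_mat_vec_carrier)
  have "Q * Q\<^sup>T = 1\<^sub>m n"
    using Q by (intro mat_mult_left_right_inverse[OF _ _ Q(2)]) auto
  then have Qw: "Q *\<^sub>v w = x"
    unfolding w_def using Q x by (simp flip: assoc_mult_mat_vec[of _ n n _ n])
  have off: "blk_offset b (Suc i) \<le> n" if "i \<le> p" for i
    using blk_offset_mono[of "Suc i" "Suc p" b] that n by simp
  have Qi_eq: "block_col b Q i = slice Q 0 n (blk_offset b i) (blk_offset b (Suc i))" if "i \<le> p" for i
    using Q off[OF that] by (simp add: block_col_eq_slice)
  have Qi: "block_col b Q i \<in> carrier_mat n (b i)" if "i \<le> p" for i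
    unfolding Qi_eq[OF that] using slice_carrier[of Q 0 n "blk_offset b i" "blk_offset b (Suc i)"]
    by (simp add: blk_offset_Suc)
  define wi where "wi i = vec (b i) (\<lambda>t. vec_index w (blk_offset b i + t))" for i
  have QTx: "(block_col b Q i)\<^sup>T *\<^sub>v x = wi i" if "i \<le> p" for i
    using that off[OF that] Q x
    by (intro eq_vecI) (auto simp: Qi_eq wi_def w_def blk_offset_Suc scalar_prod_def intro!: sum.cong)
  have wi0: "wi i = 0\<^sub>v (b i)" if "i \<le> p" "i \<noteq> m" for i
  proof (rule eq_vecI)
    fix t assume "t < dim_vec (0\<^sub>v (b i) :: real vec)"
    then have t: "t < b i" by simp
    have "blk_index b (blk_offset b i + t) = i"
      using t by (intro blk_index_eq) (auto simp: blk_offset_Suc)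
    then show "vec_index (wi i) t = vec_index (0\<^sub>v (b i)) t"
      using that t off[OF that(1)] supp[of "blk_offset b i + t"] by (simp add: wi_def w_def blk_offset_Suc)
  qed (simp add: wi_def)
  have Qmw: "block_col b Q m *\<^sub>v wi m = x"
  proof -
    have "block_col b Q m *\<^sub>v wi m = Q *\<^sub>v w"
    proof (rule eq_vecI)
      fix s assume "s < dim_vec (Q *\<^sub>v w)"
      then have s: "s < n" using Q by simp
      have "vec_index (Q *\<^sub>v w) s = (\<Sum>t<n. Q $$ (s, t) * vec_index w t)"
        using s Q w by (auto simp: scalar_prod_def atLeast0LessThan intro!: sum.cong)
      also have "\<dots> = (\<Sum>t\<in>{blk_offset b m..<blk_offset b (Suc m)}. Q $$ (s, t) * vec_index w t)"
      proof (intro sum.mono_neutral_right ballI)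
        fix t assume t: "t \<in> {..<n} - {blk_offset b m..<blk_offset b (Suc m)}"
        then have "blk_index b t \<noteq> m" using blk_index_bounds(1,2)[of t b "Suc p"] n by auto
        then show "Q $$ (s, t) * vec_index w t = 0" using supp[of t] t by (simp add: w_def)
      qed (use off[OF m] in auto)
      also have "\<dots> = (\<Sum>t<b m. Q $$ (s, blk_offset b m + t) * vec_index w (blk_offset b m + t))"
        by (rule sum.reindex_bij_witness[where i = "\<lambda>t. blk_offset b m + t" and j = "\<lambda>t. t - blk_offset b m"])
           (auto simp: blk_offset_Suc)
      also have "\<dots> = vec_index (block_col b Q m *\<^sub>v wi m) s"
        using s by (auto simp: Qi_eq[OF m] wi_def blk_offset_Suc scalar_prod_def atLeast0LessThan intro!: sum.cong)
      finally show "vec_index (block_col b Q m *\<^sub>v wi m) s = vec_index (Q *\<^sub>v w) s" ..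
    qed (use Q Qi[OF m] in auto)
    with Qw show ?thesis by simp
  qed
  define T where "T i = f i \<cdot>\<^sub>m (block_col b Q i * S i * (block_col b Q i)\<^sup>T)" for i
  have T: "T i \<in> carrier_mat n n" if "i \<le> p" for i
    using Qi[OF that] S[OF that] by (auto simp: T_def)
  have Tx: "T i *\<^sub>v x = (if i = m then (f m * c) \<cdot>\<^sub>v x else 0\<^sub>v n)" if i: "i \<le> p" for i
  proof -
    let ?Q = "block_col b Q i"
    have c: "?Q * S i \<in> carrier_mat n (b i)" "?Q * S i * ?Q\<^sup>T \<in> carrier_mat n n" "wi i \<in> carrier_vec (b i)"
      using Qi[OF i] S[OF i] by (auto simp: wi_def)
    have "T i *\<^sub>v x = f i \<cdot>\<^sub>v (?Q * S i * ?Q\<^sup>T *\<^sub>v x)"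
      using c x by (intro eq_vecI) (auto simp: T_def)
    also have "?Q * S i * ?Q\<^sup>T *\<^sub>v x = ?Q * S i *\<^sub>v wi i"
      unfolding QTx[OF i, symmetric] using c Qi[OF i] x by (intro assoc_mult_mat_vec[of _ n "b i" _ n]) auto
    also have "\<dots> = ?Q *\<^sub>v (S i *\<^sub>v wi i)"
      using c Qi[OF i] S[OF i] by (intro assoc_mult_mat_vec[of _ n "b i" _ "b i"]) auto
    also have "\<dots> = (if i = m then c \<cdot>\<^sub>v x else 0\<^sub>v n)"
    proof (cases "i = m")
      case True
      then have "S i *\<^sub>v wi i = c \<cdot>\<^sub>v wi i" using eig by (simp add: wi_def w_def)
      then show ?thesis using True Qmw Qi[OF m] c by (simp add: mult_mat_vec[of _ n "b m"])
    next
      case False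
      then show ?thesis using wi0[OF i] Qi[OF i] S[OF i]
        by (auto intro!: eq_vecI simp: scalar_prod_def)
    qed
    finally show ?thesis using x by (auto simp: smult_smult_assoc intro!: eq_vecI)
  qed
  have "mat_sum n T {..p} *\<^sub>v x = vec n (\<lambda>s. \<Sum>i\<le>p. vec_index (T i *\<^sub>v x) s)"
    using T x by (intro mat_sum_mult_vec) auto
  also have "\<dots> = (f m * c) \<cdot>\<^sub>v x"
  proof (rule eq_vecI)
    fix s assume "s < dim_vec ((f m * c) \<cdot>\<^sub>v x)"
    then have s: "s < n" using x by simp
    have "(\<Sum>i\<le>p. vec_index (T i *\<^sub>v x) s) = (\<Sum>i\<le>p. if i = m then vec_index ((f m * c) \<cdot>\<^sub>v x) s else 0)"
      using s by (intro sum.cong) (auto simp: Tx)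
    then show "vec_index (vec n (\<lambda>s. \<Sum>i\<le>p. vec_index (T i *\<^sub>v x) s)) s = vec_index ((f m * c) \<cdot>\<^sub>v x) s"
      using s m by (simp add: sum.delta)
  qed (use x in simp)
  finally show ?thesis unfolding T_def .
qed

section \<open>Grading the eigenvalue equation through the block QR factorisation\<close>

lemma powr_diag_index:
  shows "powr_diag p a \<nu> e \<in> carrier_mat (blk_offset a (Suc p)) (blk_offset a (Suc p))"
    and "s < blk_offset a (Suc p) \<Longrightarrow> t < blk_offset a (Suc p) \<Longrightarrow>
      powr_diag p a \<nu> e $$ (s, t) = (if s = t then e powr \<nu> (blk_index a t) else 0)"
proof -
  have F: "\<And>i. i < Suc p \<Longrightarrow> (e powr \<nu> i) \<cdot>\<^sub>m 1\<^sub>m (a i) \<in> carrier_mat (a i) (a i)" by simp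
  note index = diag_block_mat_index[where F = "\<lambda>i. (e powr \<nu> i) \<cdot>\<^sub>m 1\<^sub>m (a i)" and r = a and c = a, OF F]
  show "powr_diag p a \<nu> e \<in> carrier_mat (blk_offset a (Suc p)) (blk_offset a (Suc p))"
    unfolding powr_diag_def by (rule index(1))
  assume s: "s < blk_offset a (Suc p)" and t: "t < blk_offset a (Suc p)"
  show "powr_diag p a \<nu> e $$ (s, t) = (if s = t then e powr \<nu> (blk_index a t) else 0)"
  proof (cases "blk_index a s = blk_index a t")
    case True
    define i where "i = blk_index a t"
    have "blk_offset a i \<le> s" "s < blk_offset a i + a i" "blk_offset a i \<le> t" "t < blk_offset a i + a i"
      using blk_index_bounds[OF s] blk_index_bounds[OF t] True by (auto simp: i_def blk_offset_Suc)
    then have "((e powr \<nu> i) \<cdot>\<^sub>m 1\<^sub>m (a i)) $$ (s - blk_offset a i, t - blk_offset a i) =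
      (if s = t then e powr \<nu> i else 0)" by auto
    then show ?thesis
      using True index(2)[OF _ s t] unfolding powr_diag_def by (simp add: i_def del: upt_Suc)
  next
    case False
    then show ?thesis using index(2)[OF _ s t] unfolding powr_diag_def by (auto simp del: upt_Suc)
  qed
qed

text \<open>This is \<open>\<Delta>\<^sub>b\<^sup>-\<^sup>1 R \<Delta>\<^sub>a\<close>: block \<open>(i, k)\<close> of \<open>R\<close> gets multiplied by
  \<open>e powr (\<nu> k - \<nu> i)\<close>, so only the diagonal blocks of an upper triangular \<open>R\<close> survive in the limit.\<close>

definition graded_factor ::
  "nat \<Rightarrow> nat \<Rightarrow> (nat \<Rightarrow> nat) \<Rightarrow> (nat \<Rightarrow> nat) \<Rightarrow> (nat \<Rightarrow> real) \<Rightarrow> real mat \<Rightarrow> real \<Rightarrow> real mat" where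
  "graded_factor n N a b \<nu> R e =
     mat n N (\<lambda>(s, t). R $$ (s, t) * e powr (\<nu> (blk_index a t) - \<nu> (blk_index b s)))"

text \<open>An exact identity at fixed e, before any limit: R \<Delta>_a = \<Delta>_b X with X the
  graded factor, so the matrix is Q \<Delta>_b X Y \<open>X\<^sup>T\<close> \<Delta>_b
  \<open>Q\<^sup>T\<close>, and multiplying the eigenvalue equation by \<open>Q\<^sup>T\<close>
  passes to the coordinates of x in the basis Q.\<close>

lemma graded_eigenvalue_equation:
  fixes Q :: "real mat" and x :: "real vec"
  assumes N: "blk_offset a (Suc p) = N" and Q: "Q \<in> carrier_mat n n" "Q\<^sup>T * Q = 1\<^sub>m n"
    and R: "R \<in> carrier_mat n N" and V: "V = Q * R" and Y: "Y \<in> carrier_mat N N" and e: "e > 0"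
    and x: "x \<in> carrier_vec n"
    and eig: "V * powr_diag p a \<nu> e * Y * powr_diag p a \<nu> e * V\<^sup>T *\<^sub>v x = l \<cdot>\<^sub>v x"
    and s: "s < n"
  shows "(\<Sum>t<n. e powr (\<nu> (blk_index b s) + \<nu> (blk_index b t)) *
      (graded_factor n N a b \<nu> R e * Y * (graded_factor n N a b \<nu> R e)\<^sup>T) $$ (s, t) * vec_index (Q\<^sup>T *\<^sub>v x) t) =
    l * vec_index (Q\<^sup>T *\<^sub>v x) s"
proof -
  define P where "P = powr_diag p a \<nu> e"
  define X where "X = graded_factor n N a b \<nu> R e"
  define Z where "Z = R * P"
  define M where "M = Z * Y * Z\<^sup>T"
  define w where "w = Q\<^sup>T *\<^sub>v x"
  have P: "P \<in> carrier_mat N N" using powr_diag_index(1)[of p a] N by (simp add: P_def)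
  have P_index: "P $$ (s, t) = (if s = t then e powr \<nu> (blk_index a t) else 0)" if "s < N" "t < N" for s t
    using powr_diag_index(2)[of s a p t] that N by (simp add: P_def)
  have PT: "P\<^sup>T = P" using P P_index by (intro eq_matI) auto
  have X: "X \<in> carrier_mat n N" by (simp add: X_def graded_factor_def)
  have Z: "Z \<in> carrier_mat n N" using R P by (simp add: Z_def)
  have M: "M \<in> carrier_mat n n" using Z Y by (simp add: M_def)
  have w: "w \<in> carrier_vec n" using Q x by (auto simp: w_def intro!: mult_mat_vec_carrier)
  have Z_index: "Z $$ (s, t) = e powr \<nu> (blk_index b s) * X $$ (s, t)" if "s < n" "t < N" for s t
  proof -
    have "Z $$ (s, t) = (\<Sum>r<N. if r = t then R $$ (s, t) * e powr \<nu> (blk_index a t) else 0)"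
      unfolding Z_def index_mult_mat_sum[OF R P that] using that by (intro sum.cong) (auto simp: P_index)
    also have "\<dots> = R $$ (s, t) * e powr \<nu> (blk_index a t)" using that by (simp add: sum.delta)
    also have "e powr \<nu> (blk_index a t) =
      e powr \<nu> (blk_index b s) * e powr (\<nu> (blk_index a t) - \<nu> (blk_index b s))"
      by (simp flip: powr_add)
    finally show ?thesis using that by (simp add: X_def graded_factor_def)
  qed
  have ZY_index: "(Z * Y) $$ (s, t) = e powr \<nu> (blk_index b s) * (X * Y) $$ (s, t)" if "s < n" "t < N" for s t
    unfolding index_mult_mat_sum[OF Z Y that] index_mult_mat_sum[OF X Y that] sum_distrib_left
    using that by (intro sum.cong) (auto simp: Z_index)
  have M_index: "M $$ (s, t) = e powr (\<nu> (blk_index b s) + \<nu> (blk_index b t)) * (X * Y * X\<^sup>T) $$ (s, t)"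
    if "s < n" "t < n" for s t
  proof -
    have c: "Z * Y \<in> carrier_mat n N" "X * Y \<in> carrier_mat n N" "Z\<^sup>T \<in> carrier_mat N n" "X\<^sup>T \<in> carrier_mat N n"
      using X Y Z by auto
    show ?thesis
      unfolding M_def index_mult_mat_sum[OF c(1,3) that] index_mult_mat_sum[OF c(2,4) that] sum_distrib_left
      using that X Z by (intro sum.cong) (auto simp: Z_index ZY_index powr_add simp del: index_mult_mat)
  qed
  have VP: "V * P = Q * Z"
    unfolding V Z_def using Q R P by (intro assoc_mult_mat[of _ n n _ N _ N]) auto
  have Vc: "V \<in> carrier_mat n N" using V Q R by simp
  have PVT: "P * V\<^sup>T = Z\<^sup>T * Q\<^sup>T"
    using transpose_mult[OF Vc P] transpose_mult[OF Q(1) Z] VP PT by simp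
  have "V * P * Y * P * V\<^sup>T = V * P * Y * (P * V\<^sup>T)"
    using Vc P Y by (intro assoc_mult_mat[of _ n N _ N _ n]) auto
  also have "\<dots> = Q * M * Q\<^sup>T"
    unfolding VP PVT M_def using Q Z Y by (intro mult_mat_assoc5[of _ n n _ N _ N _ n _ n]) auto
  finally have K: "V * P * Y * P * V\<^sup>T = Q * M * Q\<^sup>T" .
  have "l \<cdot>\<^sub>v x = Q * M *\<^sub>v w"
    unfolding eig[symmetric] P_def[symmetric] K w_def using Q M x
    by (intro assoc_mult_mat_vec[of _ n n _ n]) auto
  also have "\<dots> = Q *\<^sub>v (M *\<^sub>v w)"
    using Q M w by (intro assoc_mult_mat_vec[of _ n n _ n]) auto
  finally have "Q\<^sup>T *\<^sub>v (l \<cdot>\<^sub>v x) = Q\<^sup>T *\<^sub>v (Q *\<^sub>v (M *\<^sub>v w))" by simp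
  also have "\<dots> = Q\<^sup>T * Q *\<^sub>v (M *\<^sub>v w)"
    using Q M w by (intro assoc_mult_mat_vec[symmetric, of _ n n _ n]) auto
  also have "\<dots> = M *\<^sub>v w" using Q M w by simp
  also have "Q\<^sup>T *\<^sub>v (l \<cdot>\<^sub>v x) = l \<cdot>\<^sub>v w"
    unfolding w_def using Q x by (intro mult_mat_vec[of _ n n]) auto
  finally have "l * vec_index w s = vec_index (M *\<^sub>v w) s"
    using s w by (metis carrier_vecD index_smult_vec(1))
  also have "\<dots> = (\<Sum>t<n. M $$ (s, t) * vec_index w t)"
    using s w M by (auto simp: scalar_prod_def atLeast0LessThan intro!: sum.cong)
  also have "\<dots> = (\<Sum>t<n. e powr (\<nu> (blk_index b s) + \<nu> (blk_index b t)) * (X * Y * X\<^sup>T) $$ (s, t) * vec_index w t)"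
    using s by (intro sum.cong) (auto simp: M_index simp del: index_mult_mat)
  finally show ?thesis by (simp add: X_def w_def)
qed

text \<open>Expresses the block diagonal part in the global indices of \<open>R\<close>, ready for
  comparison with the entrywise limit of \<open>graded_factor\<close>.\<close>

lemma diag_blocks_index:
  assumes n: "blk_offset b (Suc p) = n" and N: "blk_offset a (Suc p) = N" and R: "R \<in> carrier_mat n N"
  shows "diag_block_mat (map (\<lambda>i. block b a R i i) [0..<Suc p]) \<in> carrier_mat n N"
    and "s < n \<Longrightarrow> t < N \<Longrightarrow> diag_block_mat (map (\<lambda>i. block b a R i i) [0..<Suc p]) $$ (s, t) =
      (if blk_index b s = blk_index a t then R $$ (s, t) else 0)"
proof -
  have eq: "block b a R i i = slice R (blk_offset b i) (blk_offset b (Suc i)) (blk_offset a i) (blk_offset a (Suc i))"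
    if "i < Suc p" for i
    using blk_offset_mono[of "Suc i" "Suc p"] that n N R by (intro block_eq_slice) (metis carrier_matD Suc_leI)+
  have F: "block b a R i i \<in> carrier_mat (b i) (a i)" if "i < Suc p" for i
    unfolding eq[OF that] carrier_mat_def by (simp add: blk_offset_Suc)
  note index = diag_block_mat_index[where F = "\<lambda>i. block b a R i i" and r = b and c = a and m = "Suc p", OF F]
  show "diag_block_mat (map (\<lambda>i. block b a R i i) [0..<Suc p]) \<in> carrier_mat n N"
    using index(1) n N by simp
  assume s: "s < n" and t: "t < N"
  have s': "s < blk_offset b (Suc p)" and t': "t < blk_offset a (Suc p)" using s t n N by simp_all
  show "diag_block_mat (map (\<lambda>i. block b a R i i) [0..<Suc p]) $$ (s, t) =
      (if blk_index b s = blk_index a t then R $$ (s, t) else 0)"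
    using index(2)[OF _ s' t'] blk_index_bounds[OF s'] blk_index_bounds[OF t']
    by (auto simp: eq simp del: upt_Suc)
qed

text \<open>Invertible leading blocks make the Schur complements meaningful. \<open>H\<close> itself
  closes this chain: its determinant excludes eigenvalues of order beyond 2 \<nu> p, including those
  vanishing identically. Both sides of the first claim are explicit in \<epsilon>, so it holds for
  all positive \<epsilon> and not only near 0. The last claim also yields invertibility of the
  leading block of \<open>W\<close>, so that the inverse in it is genuine.\<close>

theorem theorem5p2:
  fixes n p :: nat
    and a b :: "nat \<Rightarrow> nat"
    and \<nu> :: "nat \<Rightarrow> real"
    and K E :: "real \<Rightarrow> real mat"
    and V W Q R H D :: "real mat"
  assumes a_pos: "\<forall>i\<le>p. a i > 0"
    and nu: "strict_mono_on {..p} \<nu>"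
    and V_dim: "V \<in> carrier_mat n (blk_offset a (Suc p))"
    and W_dim: "W \<in> carrier_mat (blk_offset a (Suc p)) (blk_offset a (Suc p))"
    and W_sym: "W\<^sup>T = W"
    and W_inv: "invertible_mat W"
    and K_analytic: "analytic_sym_mat n K"
    and E_dim: "\<forall>\<epsilon>. E \<epsilon> \<in> carrier_mat (blk_offset a (Suc p)) (blk_offset a (Suc p))"
    and E_small: "\<forall>i<blk_offset a (Suc p). \<forall>j<blk_offset a (Suc p).
                    ((\<lambda>\<epsilon>. E \<epsilon> $$ (i, j)) \<longlongrightarrow> 0) (at_right 0)"
    and K_form: "\<forall>\<^sub>F \<epsilon> in at_right 0.
                   K \<epsilon> = V * powr_diag p a \<nu> \<epsilon> * (W + E \<epsilon>) * powr_diag p a \<nu> \<epsilon> * V\<^sup>T"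
    and V_rank: "vec_space.rank n V = n"
    and b_eq: "b = block_rank_increment n a V"
    and b_pos: "\<forall>i\<le>p. b i > 0"
    and QR: "block_qr n p a b V Q R"
    and D_eq: "D = diag_block_mat (map (\<lambda>i. block b a R i i) [0..<Suc p])"
    and H_eq: "H = D * W * D\<^sup>T"
  shows
    "((\<forall>i\<in>{1..p}. invertible_mat (leading_blocks b H i)) \<and> invertible_mat H \<longrightarrow>
        (\<forall>lam u. analytic_eigensystem n K lam u \<longrightarrow>
           (\<forall>\<epsilon>>0. ase n lam u \<epsilon> =
              mat_sum n (\<lambda>i. (\<epsilon> powr (2 * \<nu> i)) \<cdot>\<^sub>m
                 (block_col b Q i * block_schur b H i * (block_col b Q i)\<^sup>T)) {..p})))
     \<and> block_schur b H 0 = block b a R 0 0 * block a a W 0 0 * (block b a R 0 0)\<^sup>T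
     \<and> (\<forall>j\<in>{1..p}.
          vec_space.rank n (block_cols_less a V j) = blk_offset a j \<and>
          invertible_mat (leading_blocks b H j) \<longrightarrow>
          invertible_mat (leading_blocks a W j) \<and>
          block_schur b H j =
            block b a R j j *
              (block a a W j j
               - block_row_less a W j * the (mat_inverse (leading_blocks a W j))
                   * (block_row_less a W j)\<^sup>T)
              * (block b a R j j)\<^sup>T)"
proof -
  define N where "N = blk_offset a (Suc p)"
  have V: "V \<in> carrier_mat n N" and W: "W \<in> carrier_mat N N"
    using V_dim W_dim by (simp_all add: N_def)
  have b_off: "blk_offset b (Suc j) = vec_space.rank n (block_cols_less a V (Suc j))" if "j \<le> p" for j
    using blk_offset_block_rank_increment[OF V_dim _ that] b_pos unfolding b_eq by simp
  have "block_cols_less a V (Suc p) = V"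
    using slice_full[OF V] V by (simp add: block_cols_less_eq_slice N_def)
  then have n: "blk_offset b (Suc p) = n" using b_off[of p] V_rank by simp
  have Q: "Q \<in> carrier_mat n n" "Q\<^sup>T * Q = 1\<^sub>m n" and R: "R \<in> carrier_mat n N" and VQR: "V = Q * R"
    and R_zero: "\<And>i k. i \<le> p \<Longrightarrow> k < i \<Longrightarrow> block b a R i k = 0\<^sub>m (b i) (a k)"
    using QR unfolding block_qr_def N_def by auto
  note Nd = N_def[symmetric]
  have D: "D \<in> carrier_mat n N"
    and D_index: "\<And>s t. s < n \<Longrightarrow> t < N \<Longrightarrow>
      D $$ (s, t) = (if blk_index b s = blk_index a t then R $$ (s, t) else 0)"
    unfolding D_eq using diag_blocks_index[OF n Nd R] by blast+
  have H: "H \<in> carrier_mat n n" using D W by (simp add: H_eq)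
  have "H\<^sup>T = (D\<^sup>T)\<^sup>T * (D * W)\<^sup>T"
    unfolding H_eq using D W by (intro transpose_mult[of _ n N _ n]) auto
  then have "H\<^sup>T = D * (W * D\<^sup>T)"
    unfolding transpose_mult[OF D W] W_sym by simp
  then have H_sym: "H\<^sup>T = H"
    unfolding H_eq using D W by (simp add: assoc_mult_mat[of _ n N _ N _ n])
  have off_b: "blk_offset b i \<le> n" and off_a: "blk_offset a i \<le> N" if "i \<le> Suc p" for i
    using blk_offset_mono[OF that] n by (auto simp: N_def)
  have idx_b: "blk_index b s < i \<longleftrightarrow> s < blk_offset b i" if "s < n" for s i
    using blk_index_less_iff[of s b "Suc p"] that n by simp
  have idx_a: "blk_index a t < i \<longleftrightarrow> t < blk_offset a i" if "t < N" for t i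
    using blk_index_less_iff[of t a "Suc p"] that by (simp add: N_def)
  have R_lower: "R $$ (s, t) = 0" if s: "s < n" and t: "t < N" and lt: "blk_index a t < blk_index b s" for s t
  proof -
    define i k where "i = blk_index b s" and "k = blk_index a t"
    have s': "s < blk_offset b (Suc p)" and t': "t < blk_offset a (Suc p)" using s t n by (simp_all add: N_def)
    note i = blk_index_bounds[OF s', folded i_def] and k = blk_index_bounds[OF t', folded k_def]
    have "block b a R i k = slice R (blk_offset b i) (blk_offset b (Suc i)) (blk_offset a k) (blk_offset a (Suc k))"
      using off_b[of "Suc i"] off_a[of "Suc k"] i(3) k(3) R by (intro block_eq_slice) auto
    moreover have "block b a R i k = 0\<^sub>m (b i) (a k)"
      using R_zero[of i k] i(3) lt by (simp add: i_def k_def)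
    ultimately have "slice R (blk_offset b i) (blk_offset b (Suc i)) (blk_offset a k) (blk_offset a (Suc k)) = 0\<^sub>m (b i) (a k)"
      by simp
    from arg_cong[OF this, of "\<lambda>M. M $$ (s - blk_offset b i, t - blk_offset a k)"]
    show ?thesis using i k by (simp add: blk_offset_Suc less_diff_conv2 add.commute)
  qed
  \<comment> \<open>This and \<open>D_lead\<close> are the two zero patterns for slicing
    \<open>H\<close>: rows of one block meet only the columns of that block, and leading row blocks
    meet only leading column blocks.\<close>
  have D_row: "D $$ (s, t) = 0"
    if "blk_offset b j \<le> s" "s < blk_offset b (Suc j)" "t < N"
      "\<not> (blk_offset a j \<le> t \<and> t < blk_offset a (Suc j))" "j \<le> p" for j s t
  proof -
    have "s < n" using that off_b[of "Suc j"] by simp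
    moreover have "blk_index b s = j" using that by (intro blk_index_eq)
    moreover have "blk_index a t \<noteq> j"
      using idx_a[OF that(3), of j] idx_a[OF that(3), of "Suc j"] that(4) by auto
    ultimately show ?thesis using D_index that(3) by simp
  qed
  have D_lead: "D $$ (s, t) = 0"
    if "s < blk_offset b j" "t < N" "\<not> t < blk_offset a j" "j \<le> p" for j s t
  proof -
    have "s < n" using that off_b[of j] by simp
    then show ?thesis using D_index[of s t] idx_b[of s j] idx_a[of t j] that by auto
  qed
  have D_blk: "slice D (blk_offset b j) (blk_offset b (Suc j)) (blk_offset a j) (blk_offset a (Suc j)) = block b a R j j"
    if j: "j \<le> p" for j
  proof -
    have "block b a R j j = slice R (blk_offset b j) (blk_offset b (Suc j)) (blk_offset a j) (blk_offset a (Suc j))"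
      using off_b[of "Suc j"] off_a[of "Suc j"] j R by (intro block_eq_slice) auto
    moreover have "D $$ (blk_offset b j + s, blk_offset a j + t) = R $$ (blk_offset b j + s, blk_offset a j + t)"
      if "s < b j" "t < a j" for s t
    proof -
      have "blk_index b (blk_offset b j + s) = j" "blk_index a (blk_offset a j + t) = j"
        using that by (auto intro!: blk_index_eq simp: blk_offset_Suc)
      then show ?thesis using D_index off_b[of "Suc j"] off_a[of "Suc j"] j that by (simp add: blk_offset_Suc)
    qed
    ultimately show ?thesis by (auto intro!: eq_matI simp: blk_offset_Suc)
  qed
  have block_H: "block b b H j j = block b a R j j * block a a W j j * (block b a R j j)\<^sup>T" if j: "j \<le> p" for j
  proof -
    have "block b b H j j = slice H (blk_offset b j) (blk_offset b (Suc j)) (blk_offset b j) (blk_offset b (Suc j))"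
      using off_b[of "Suc j"] j H by (intro block_eq_slice) auto
    also have "\<dots> = block b a R j j * slice W (blk_offset a j) (blk_offset a (Suc j)) (blk_offset a j) (blk_offset a (Suc j))
        * (block b a R j j)\<^sup>T"
      unfolding H_eq D_blk[OF j, symmetric]
      using D_row[OF _ _ _ _ j] off_b[of "Suc j"] off_a[of "Suc j"] j by (intro slice_congruence[OF D W]) auto
    also have "slice W (blk_offset a j) (blk_offset a (Suc j)) (blk_offset a j) (blk_offset a (Suc j)) = block a a W j j"
      using off_a[of "Suc j"] j W by (intro block_eq_slice[symmetric]) auto
    finally show ?thesis .
  qed

  have part2_0: "block_schur b H 0 = block b a R 0 0 * block a a W 0 0 * (block b a R 0 0)\<^sup>T"
    using block_H[of 0] by (simp add: block_schur_def)

  have part2: "invertible_mat (leading_blocks a W j) \<and>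
          block_schur b H j =
            block b a R j j *
              (block a a W j j
               - block_row_less a W j * the (mat_inverse (leading_blocks a W j))
                   * (block_row_less a W j)\<^sup>T)
              * (block b a R j j)\<^sup>T"
    if j: "j \<in> {1..p}" and rank: "vec_space.rank n (block_cols_less a V j) = blk_offset a j"
      and inv: "invertible_mat (leading_blocks b H j)" for j
  proof -
    have jp: "j \<le> p" using j by simp
    define q where "q = blk_offset a j"
    \<comment> \<open>Full column rank enters here: the rank of the first j column blocks is offset
      j of b in any case, and now equals their number of columns. Hence the leading part
      \<open>L\<close> of \<open>D\<close> is square.\<close>
    have q: "blk_offset b j = q" using b_off[of "j - 1"] j rank by (cases j) (auto simp: q_def)
    have le: "q \<le> n" "q \<le> N" "blk_offset b (Suc j) \<le> n" "blk_offset a (Suc j) \<le> N"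
      using off_b[of j] off_b[of "Suc j"] off_a[of j] off_a[of "Suc j"] jp q by (auto simp: q_def)
    define L where "L = slice D 0 q 0 q"
    have L: "L \<in> carrier_mat q q" using slice_carrier[of D 0 q 0 q] by (simp add: L_def)
    have lead_W: "leading_blocks a W j = slice W 0 q 0 q"
      using leading_blocks_eq_slice[of a j W] le W by (simp add: q_def)
    have lead_W_c: "leading_blocks a W j \<in> carrier_mat q q"
      using slice_carrier[of W 0 q 0 q] by (simp add: lead_W)
    have "leading_blocks b H j = slice H 0 q 0 q"
      using leading_blocks_eq_slice[of b j H] le H q by simp
    also have "\<dots> = L * slice W 0 q 0 q * L\<^sup>T"
      unfolding H_eq L_def using D_lead[of _ j] jp q le
      by (intro slice_congruence[OF D W]) (auto simp: q_def)
    finally have lead: "leading_blocks b H j = L * leading_blocks a W j * L\<^sup>T" by (simp add: lead_W)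
    have "block_row_less b H j = slice H q (blk_offset b (Suc j)) 0 q"
      using block_row_less_eq_slice[of b j H] le H q by simp
    also have "\<dots> = slice D q (blk_offset b (Suc j)) q (blk_offset a (Suc j))
       * slice W q (blk_offset a (Suc j)) 0 q * L\<^sup>T"
      unfolding H_eq L_def using D_lead[of _ j] D_row[OF _ _ _ _ jp] jp q le
      by (intro slice_congruence[OF D W]) (auto simp: q_def)
    also have "slice D q (blk_offset b (Suc j)) q (blk_offset a (Suc j)) = block b a R j j"
      using D_blk[OF jp] q by (simp add: q_def)
    also have "slice W q (blk_offset a (Suc j)) 0 q = block_row_less a W j"
      using block_row_less_eq_slice[of a j W] le W by (simp add: q_def)
    finally have row: "block_row_less b H j = block b a R j j * block_row_less a W j * L\<^sup>T" .
    have c: "block b a R j j \<in> carrier_mat (b j) (a j)" "block a a W j j \<in> carrier_mat (a j) (a j)"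
      "block_row_less a W j \<in> carrier_mat (a j) q"
      using le W R block_eq_slice[of b j R a j] block_eq_slice[of a j W a j] block_row_less_eq_slice[of a j W]
      unfolding carrier_mat_def by (simp_all add: q_def blk_offset_Suc)
    have "leading_blocks b H j \<in> carrier_mat q q"
      unfolding lead using L lead_W_c by simp
    from inv[unfolded invertible_mat_iff_det[OF this]]
    have "det (L * leading_blocks a W j * L\<^sup>T) \<noteq> 0" unfolding lead .
    note sc = schur_complement_congruence[OF L lead_W_c c(1,3,2) this]
    have "block_schur b H j = block b b H j j - block_row_less b H j * the (mat_inverse (leading_blocks b H j))
             * (block_row_less b H j)\<^sup>T"
      using j by (simp add: block_schur_def)
    also have "\<dots> = block b a R j j *
              (block a a W j j
               - block_row_less a W j * the (mat_inverse (leading_blocks a W j))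
                   * (block_row_less a W j)\<^sup>T)
              * (block b a R j j)\<^sup>T"
      unfolding block_H[OF jp] row lead by (rule sc(2))
    finally show ?thesis
      using sc(1) invertible_mat_iff_det[OF lead_W_c] by simp
  qed

  have part1: "ase n lam u \<epsilon> = mat_sum n (\<lambda>i. (\<epsilon> powr (2 * \<nu> i)) \<cdot>\<^sub>m
                 (block_col b Q i * block_schur b H i * (block_col b Q i)\<^sup>T)) {..p}"
    if inv: "\<And>i. i \<in> {1..p} \<Longrightarrow> invertible_mat (leading_blocks b H i)" and invH: "invertible_mat H"
      and sys: "analytic_eigensystem n K lam u" and \<epsilon>: "\<epsilon> > 0" for lam u \<epsilon>
  proof -
    have lam: "analytic_at_0 (lam k)" and uc: "u k e \<in> carrier_vec n"
      and ua: "i < n \<Longrightarrow> analytic_at_0 (\<lambda>e. vec_index (u k e) i)" if "k < n" for k e i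
      using sys that unfolding analytic_eigensystem_def by auto
    have ev_eig: "\<forall>\<^sub>F e in nhds 0. \<forall>k<n. K e *\<^sub>v u k e = lam k e \<cdot>\<^sub>v u k e"
      and ev_orth: "\<forall>\<^sub>F e in nhds 0. \<forall>k<n. \<forall>l<n. scalar_prod (u k e) (u l e) = (if k = l then 1 else 0)"
      using sys unfolding analytic_eigensystem_def by auto
    have orth: "scalar_prod (u k 0) (u l 0) = (if k = l then 1 else 0)" if "k < n" "l < n" for k l
      using eventually_nhds_x_imp_x[OF ev_orth] that by blast
    have lead: "det (slice H 0 (blk_offset b i) 0 (blk_offset b i)) \<noteq> 0" if i: "i \<le> Suc p" for i
    proof -
      \<comment> \<open>The two ends are the empty determinant, which is 1, and the determinant of
        \<open>H\<close> itself.\<close>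
      consider "i = 0" | "i = Suc p" | "i \<in> {1..p}" using i by fastforce
      then show ?thesis
      proof cases
        case 1
        have "slice H 0 0 0 0 \<in> carrier_mat 0 0" using slice_carrier[of H 0 0 0 0] by simp
        from det_dim_zero[OF this] show ?thesis using 1 by simp
      next
        case 2
        then show ?thesis using invH invertible_mat_iff_det[OF H] slice_full[OF H] n by simp
      next
        case 3
        have "leading_blocks b H i = slice H 0 (blk_offset b i) 0 (blk_offset b i)"
          using off_b[OF i] H by (intro leading_blocks_eq_slice) auto
        moreover have "slice H 0 (blk_offset b i) 0 (blk_offset b i) \<in> carrier_mat (blk_offset b i) (blk_offset b i)"
          using slice_carrier[of H 0 "blk_offset b i" 0 "blk_offset b i"] by simp
        ultimately show ?thesis using inv[OF 3] invertible_mat_iff_det by metis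
      qed
    qed
    have S: "block_schur b H i \<in> carrier_mat (b i) (b i)" if i: "i \<le> p" for i
      \<comment> \<open>Only the dimension is wanted, and the zero vector satisfies the condition on
        the earlier rows.\<close>
      using block_schur_slice(1)[OF H _ H_sym lead, of i "\<lambda>_. 0"] off_b[of "Suc i"] i by simp
    define X where "X = graded_factor n N a b \<nu> R"
    define B where "B e = X e * (W + E e) * (X e)\<^sup>T" for e
    have X_lim: "entries_tendsto X D n N (at_right 0)"
    proof -
      have "((\<lambda>e. R $$ (s, t) * e powr (\<nu> (blk_index a t) - \<nu> (blk_index b s))) \<longlongrightarrow> D $$ (s, t)) (at_right 0)"
        if s: "s < n" and t: "t < N" for s t
      proof (cases "blk_index b s" "blk_index a t" rule: linorder_cases)
        case less
        have "blk_index b s \<in> {..p}" "blk_index a t \<in> {..p}"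
          using idx_b[OF s, of "Suc p"] idx_a[OF t, of "Suc p"] s t n by (auto simp: N_def)
        with less have "\<nu> (blk_index b s) < \<nu> (blk_index a t)"
          using strict_mono_on_less[OF nu] by blast
        then have "((\<lambda>e. R $$ (s, t) * e powr (\<nu> (blk_index a t) - \<nu> (blk_index b s))) \<longlongrightarrow> R $$ (s, t) * 0) (at_right 0)"
          by (intro tendsto_mult tendsto_const tendsto_powr_at_right_0) simp
        then show ?thesis using less D_index[OF s t] by simp
      next
        case equal
        have "((\<lambda>e. R $$ (s, t) * e powr 0) \<longlongrightarrow> R $$ (s, t) * 1) (at_right 0)"
          by (intro tendsto_mult tendsto_const tendsto_powr_0_at_right_0)
        then show ?thesis using equal D_index[OF s t] by (simp del: powr_zero_eq_one)
      next
        \<comment> \<open>Below the block diagonal the power of e diverges; block triangularity of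
          \<open>R\<close> removes these entries altogether.\<close>
        case greater
        then show ?thesis using R_lower[OF s t] D_index[OF s t] by simp
      qed
      then show ?thesis using D by (simp add: entries_tendsto_def X_def graded_factor_def)
    qed
    have WE_lim: "entries_tendsto (\<lambda>e. W + E e) W N N (at_right 0)"
    proof -
      have "((\<lambda>e. W $$ (i, j) + E e $$ (i, j)) \<longlongrightarrow> W $$ (i, j) + 0) (at_right 0)" if "i < N" "j < N" for i j
        using E_small that unfolding N_def by (intro tendsto_add tendsto_const) auto
      moreover have "E e \<in> carrier_mat N N" for e using E_dim by (simp add: N_def)
      note carrier_matD[OF this] this
      ultimately show ?thesis using W by (simp add: entries_tendsto_def)
    qed
    have B_lim: "entries_tendsto B H n n (at_right 0)"
      unfolding B_def H_eq
      by (rule entries_tendsto_times[OF entries_tendsto_times[OF X_lim WE_lim] entries_tendsto_transpose[OF X_lim]])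
    have "\<exists>m\<le>p. \<exists>c. leading_term (lam k) \<epsilon> = c * \<epsilon> powr (2 * \<nu> m) \<and>
        (\<forall>s<n. blk_index b s \<noteq> m \<longrightarrow> vec_index (Q\<^sup>T *\<^sub>v u k 0) s = 0) \<and>
        block_schur b H m *\<^sub>v vec (b m) (\<lambda>t. vec_index (Q\<^sup>T *\<^sub>v u k 0) (blk_offset b m + t)) =
          c \<cdot>\<^sub>v vec (b m) (\<lambda>t. vec_index (Q\<^sup>T *\<^sub>v u k 0) (blk_offset b m + t))" if k: "k < n" for k
    proof -
      have QTu: "vec_index (Q\<^sup>T *\<^sub>v u k e) s = (\<Sum>t<n. Q $$ (t, s) * vec_index (u k e) t)" if "s < n" for s e
        using that Q(1) uc[OF k, of e] by (auto simp: scalar_prod_def atLeast0LessThan intro!: sum.cong)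
      have v_lim: "((\<lambda>e. vec_index (Q\<^sup>T *\<^sub>v u k e) s) \<longlongrightarrow> vec_index (Q\<^sup>T *\<^sub>v u k 0) s) (at_right 0)" if s: "s < n" for s
        unfolding QTu[OF s]
      proof (intro tendsto_sum tendsto_mult tendsto_const)
        fix t assume "t \<in> {..<n}"
        then obtain F where "(\<lambda>e. vec_index (u k e) t) has_fps_expansion F"
          using ua[OF k, of t] by (auto simp: analytic_at_0_def)
        from has_fps_expansion_imp_continuous[OF this, of "{0<..}"]
        show "((\<lambda>e. vec_index (u k e) t) \<longlongrightarrow> vec_index (u k 0) t) (at_right 0)"
          by (simp add: continuous_within)
      qed
      have QQT: "Q * Q\<^sup>T = 1\<^sub>m n"
        using Q by (intro mat_mult_left_right_inverse[OF _ _ Q(2)]) auto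
      \<comment> \<open>Orthonormality persists at 0 itself, so u(0) has norm 1 and the orthogonal
        matrix \<open>Q\<^sup>T\<close> cannot annihilate it.\<close>
      have nz: "\<exists>s<n. vec_index (Q\<^sup>T *\<^sub>v u k 0) s \<noteq> 0"
      proof (rule ccontr)
        assume "\<not> ?thesis"
        then have "Q\<^sup>T *\<^sub>v u k 0 = 0\<^sub>v n" using Q(1) by (intro eq_vecI) auto
        then have "Q * Q\<^sup>T *\<^sub>v u k 0 = Q *\<^sub>v 0\<^sub>v n"
          using Q(1) uc[OF k, of 0] by (simp add: assoc_mult_mat_vec[of _ n n _ n])
        moreover have "Q *\<^sub>v 0\<^sub>v n = 0\<^sub>v n" using Q(1) by (intro eq_vecI) auto
        ultimately have "u k 0 = 0\<^sub>v n" using QQT uc[OF k, of 0] by simp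
        then show False using orth[OF k k] by simp
      qed
      have ev_eig_right: "\<forall>\<^sub>F e in at_right 0. \<forall>k<n. K e *\<^sub>v u k e = lam k e \<cdot>\<^sub>v u k e"
        unfolding eventually_at_filter using ev_eig by (rule eventually_mono) simp
      have "\<forall>\<^sub>F e in at_right 0. \<forall>s<n.
        (\<Sum>t<n. e powr (\<nu> (blk_index b s) + \<nu> (blk_index b t)) * B e $$ (s, t) * vec_index (Q\<^sup>T *\<^sub>v u k e) t) =
        lam k e * vec_index (Q\<^sup>T *\<^sub>v u k e) s"
        using K_form eventually_pos_at_right_0 ev_eig_right
      proof eventually_elim
        case (elim e)
        have "W + E e \<in> carrier_mat N N" using E_dim by (simp add: N_def)
        moreover have "V * powr_diag p a \<nu> e * (W + E e) * powr_diag p a \<nu> e * V\<^sup>T *\<^sub>v u k e = lam k e \<cdot>\<^sub>v u k e"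
          using elim k by simp
        ultimately show ?case
          unfolding B_def X_def using elim(2) uc[OF k, of e]
          by (intro allI impI graded_eigenvalue_equation[OF Nd Q R VQR])
      qed
      from graded_eigenvector_limit[OF nu n H H_sym lead B_lim v_lim nz lam[OF k] this]
      show ?thesis using \<epsilon> by metis
    qed
    then obtain m c where mc: "\<And>k. k < n \<Longrightarrow> m k \<le> p"
      "\<And>k. k < n \<Longrightarrow> leading_term (lam k) \<epsilon> = c k * \<epsilon> powr (2 * \<nu> (m k))"
      "\<And>k s. k < n \<Longrightarrow> s < n \<Longrightarrow> blk_index b s \<noteq> m k \<Longrightarrow> vec_index (Q\<^sup>T *\<^sub>v u k 0) s = 0"
      "\<And>k. k < n \<Longrightarrow> block_schur b H (m k) *\<^sub>v vec (b (m k)) (\<lambda>t. vec_index (Q\<^sup>T *\<^sub>v u k 0) (blk_offset b (m k) + t)) =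
          c k \<cdot>\<^sub>v vec (b (m k)) (\<lambda>t. vec_index (Q\<^sup>T *\<^sub>v u k 0) (blk_offset b (m k) + t))"
      by metis
    show ?thesis
    proof (rule mat_eq_if_agree_on_orthonormal[where u = "\<lambda>k. u k 0"])
      fix k assume k: "k < n"
      have "ase n lam u \<epsilon> *\<^sub>v u k 0 = leading_term (lam k) \<epsilon> \<cdot>\<^sub>v u k 0"
        using uc orth k by (intro ase_mult_eigenvector) auto
      also have "\<dots> = (\<epsilon> powr (2 * \<nu> (m k)) * c k) \<cdot>\<^sub>v u k 0" by (simp add: mc(2)[OF k] mult.commute)
      also have "\<dots> = mat_sum n (\<lambda>i. (\<epsilon> powr (2 * \<nu> i)) \<cdot>\<^sub>m
                 (block_col b Q i * block_schur b H i * (block_col b Q i)\<^sup>T)) {..p} *\<^sub>v u k 0"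
        by (rule block_sum_mult_eigenvector[symmetric, OF n Q uc[OF k] S mc(1)[OF k] mc(3)[OF k] mc(4)[OF k]])
      finally show "ase n lam u \<epsilon> *\<^sub>v u k 0 = mat_sum n (\<lambda>i. (\<epsilon> powr (2 * \<nu> i)) \<cdot>\<^sub>m
                 (block_col b Q i * block_schur b H i * (block_col b Q i)\<^sup>T)) {..p} *\<^sub>v u k 0" .
    qed (use uc orth in \<open>auto simp: ase_def\<close>)
  qed
  show ?thesis using part1 part2_0 part2 by blast
qed

end
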